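(* Let $F$ and $G$ be real Hilbert spaces and let $S:F\to G$ be a compact linear operator. Then for all $n\in\mathbb{N}=\{1,2,\dots\}$, $$\tfrac12\,e^{\rm all\text{-}wor}_{4n-1}(S)\le\widetilde e_n^{\rm \,all\text{-}ran}(S)\le e_n^{\rm all\text{-}wor}(S).$$
   Context: Let $\Lambda^{\rm all}$ be the class of all continuous linear functionals $F\to\mathbb{R}$ and $\widetilde\Lambda^{\rm all}$ the class of all linear functionals $F\to\mathbb{R}$, continuous or not. Worst case setting. For an integer $n\ge0$, a deterministic algorithm $A_n:F\to G$ using $n$ functionals from a class $\Lambda$ is a mapping $A_n(f)=\phi_n(y_1,\dots,y_n)$ with $y_j=L_j(f;y_1,\dots,y_{j-1})$, where $\phi_n:\mathbb{R}^n\to G$ is arbitrary and $L_j(\cdot\,;y_1,\dots,y_{j-1})\in\Lambda$ for all $j$ and all $y_1,\dots,y_{j-1}\in\mathbb{R}$ (adaptive choice of functionals is allowed; for $n=0$, $A_0$ is constant). Its worst case error is $e(A_n)=\sup_{\|f\|_F<1}\|S(f)-A_n(f)\|_G$, and $$e_n^{\rm all\text{-}wor}(S)=\inf\{e(A_n):A_n\text{ uses }n\text{ functionals from }\Lambda^{\rm all}\}.$$ Randomized setting. A randomized algorithm $A$ using functionals from $\Lambda$ consists of a probability space $(\Omega,\Sigma,\mu)$ and a family $(N_\omega,\phi_\omega)_{\omega\in\Omega}$ such that: (1) for each fixed $\omega$, $A_\omega=\phi_\omega\circ N_\omega$ is a deterministic algorithm based on adaptive information $N_\omega$ consisting of linear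 functionals from $\Lambda$ (the number of functionals used may also vary with $f$, being determined adaptively from the computed values); (2) if $n(f,\omega)$ denotes the number of functionals used by $N_\omega$ for $f\in F$, then the function $n$ is measurable; (3) the mapping $(f,\omega)\mapsto\phi_\omega(N_\omega(f))\in G$ is measurable. Measurability is with respect to the Borel $\sigma$-fields on $F$ and $G$ and the $\sigma$-field $\Sigma$ on $\Omega$. The cardinality and the error of $A$ are $$n(A)=\sup_{\|f\|_F<1}\int_\Omega n(f,\omega)\,d\mu(\omega),\qquad e^{\rm ran}(A)=\sup_{\|f\|_F<1}\left(\int_\Omega\|S(f)-\phi_\omega(N_\omega(f))\|_G^2\,d\mu(\omega)\right)^{1/2}.$$ The $n$th minimal randomized error for $\widetilde\Lambda^{\rm all}$ is $$\widetilde e_n^{\rm \,all\text{-}ran}(S)=\inf\{e^{\rm ran}(A): A\text{ uses functionals from }\widetilde\Lambda^{\rm all},\ n(A)\le n\}.$$ *)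

theory Defs
  imports "HOL-Probability.Probability"
begin

definition compact_linear_operator :: "('f::real_normed_vector \<Rightarrow> 'g::real_normed_vector) \<Rightarrow> bool" where
  "compact_linear_operator S \<longleftrightarrow> linear S \<and> (\<forall>B. bounded B \<longrightarrow> compact (closure (S ` B)))"

definition continuous_functionals :: "('f::real_normed_vector \<Rightarrow> real) set" where
  "continuous_functionals = {l. bounded_linear l}"

definition linear_functionals :: "('f::real_vector \<Rightarrow> real) set" where
  "linear_functionals = {l. linear l}"

text \<open>An adaptive choice of functionals is a map \<open>L\<close> from finite sequences of observed values to
  functionals: \<open>L [y\<^sub>1, \<dots>, y\<^sub>j\<^sub>-\<^sub>1]\<close> is the functional \<open>L\<^sub>j(\<cdot>; y\<^sub>1, \<dots>, y\<^sub>j\<^sub>-\<^sub>1)\<close>, the index \<open>j\<close> being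
  recovered from the length of the list. \<open>info L f n\<close> is the list \<open>[y\<^sub>1, \<dots>, y\<^sub>n]\<close> of the first
  \<open>n\<close> values observed for the input \<open>f\<close>.\<close>

primrec info :: "(real list \<Rightarrow> 'f \<Rightarrow> real) \<Rightarrow> 'f \<Rightarrow> nat \<Rightarrow> real list" where
  "info L f 0 = []"
| "info L f (Suc n) = info L f n @ [L (info L f n) f]"

definition det_algorithm :: "('f \<Rightarrow> real) set \<Rightarrow> nat \<Rightarrow> ('f \<Rightarrow> 'g) \<Rightarrow> bool" where
  "det_algorithm \<Lambda> n A \<longleftrightarrow>
     (\<exists>L \<phi>. (\<forall>ys. length ys < n \<longrightarrow> L ys \<in> \<Lambda>) \<and> A = (\<lambda>f. \<phi> (info L f n)))"

text \<open>Errors and cardinalities are extended nonnegative reals, since a given algorithm may have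
  infinite error.\<close>

definition wor_error ::
  "('f::real_normed_vector \<Rightarrow> 'g::real_normed_vector) \<Rightarrow> ('f \<Rightarrow> 'g) \<Rightarrow> ennreal" where
  "wor_error S A = (SUP f\<in>{f. norm f < 1}. ennreal (norm (S f - A f)))"

definition min_wor_error ::
  "('f \<Rightarrow> real) set \<Rightarrow> nat \<Rightarrow> ('f::real_normed_vector \<Rightarrow> 'g::real_normed_vector) \<Rightarrow> ennreal" where
  "min_wor_error \<Lambda> n S = (INF A\<in>{A. det_algorithm \<Lambda> n A}. wor_error S A)"

text \<open>A randomized algorithm: for each \<open>\<omega>\<close> an adaptive choice of functionals, a stopping rule (a
  predicate on the values observed so far) and an output map.\<close>

record ('w, 'f, 'g) randomized_algorithm =
  space_of :: "'w measure"
  choose_functional :: "'w \<Rightarrow> real list \<Rightarrow> 'f \<Rightarrow> real"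
  stop_rule :: "'w \<Rightarrow> real list \<Rightarrow> bool"
  output_map :: "'w \<Rightarrow> real list \<Rightarrow> 'g"

definition num_used :: "('w, 'f, 'g) randomized_algorithm \<Rightarrow> 'f \<Rightarrow> 'w \<Rightarrow> nat" where
  "num_used A f \<omega> = (LEAST k. stop_rule A \<omega> (info (choose_functional A \<omega>) f k))"

definition run :: "('w, 'f, 'g) randomized_algorithm \<Rightarrow> 'f \<Rightarrow> 'w \<Rightarrow> 'g" where
  "run A f \<omega> = output_map A \<omega> (info (choose_functional A \<omega>) f (num_used A f \<omega>))"

text \<open>The third condition says that the algorithm terminates on every input, so that the
  \<open>LEAST\<close> in \<open>num_used\<close> is meaningful.\<close>

definition valid_randomized ::
  "('f \<Rightarrow> real) set \<Rightarrow> ('w, 'f::real_normed_vector, 'g::real_normed_vector) randomized_algorithm \<Rightarrow> bool"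
where
  "valid_randomized \<Lambda> A \<longleftrightarrow>
     prob_space (space_of A) \<and>
     (\<forall>\<omega>\<in>space (space_of A). \<forall>ys. choose_functional A \<omega> ys \<in> \<Lambda>) \<and>
     (\<forall>\<omega>\<in>space (space_of A). \<forall>f. \<exists>k. stop_rule A \<omega> (info (choose_functional A \<omega>) f k)) \<and>
     (\<lambda>(f, \<omega>). num_used A f \<omega>) \<in> borel \<Otimes>\<^sub>M space_of A \<rightarrow>\<^sub>M count_space UNIV \<and>
     (\<lambda>(f, \<omega>). run A f \<omega>) \<in> borel \<Otimes>\<^sub>M space_of A \<rightarrow>\<^sub>M borel"

definition ran_cardinality :: "('w, 'f::real_normed_vector, 'g) randomized_algorithm \<Rightarrow> ennreal" where
  "ran_cardinality A =
     (SUP f\<in>{f. norm f < 1}. \<integral>\<^sup>+ \<omega>. of_nat (num_used A f \<omega>) \<partial>space_of A)"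

definition ennreal_sqrt :: "ennreal \<Rightarrow> ennreal" where
  "ennreal_sqrt x = (if x = \<top> then \<top> else ennreal (sqrt (enn2real x)))"

definition ran_error ::
  "('f \<Rightarrow> 'g) \<Rightarrow> ('w, 'f::real_normed_vector, 'g::real_normed_vector) randomized_algorithm \<Rightarrow> ennreal"
where
  "ran_error S A =
     (SUP f\<in>{f. norm f < 1}.
        ennreal_sqrt (\<integral>\<^sup>+ \<omega>. ennreal ((norm (S f - run A f \<omega>))\<^sup>2) \<partial>space_of A))"

text \<open>HOL cannot quantify over all types inside a term, so the type of elementary events is an
  explicit parameter. A statement that leaves \<open>'w\<close> free covers probability spaces over every
  type.\<close>

definition min_ran_error ::
  "'w itself \<Rightarrow> ('f \<Rightarrow> real) set \<Rightarrow> nat \<Rightarrow>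
     ('f::real_normed_vector \<Rightarrow> 'g::real_normed_vector) \<Rightarrow> ennreal" where
  "min_ran_error _ \<Lambda> n S =
     (INF A\<in>{A :: ('w, 'f, 'g) randomized_algorithm.
               valid_randomized \<Lambda> A \<and> ran_cardinality A \<le> of_nat n}. ran_error S A)"

end

theory Submission
  imports Defs
begin

text \<open>Greedy maximisation of \<open>norm (S f)\<close> over unit vectors orthogonal to the earlier choices gives a
  singular system \<open>e\<close>, and with \<open>s\<^sub>n = norm (S (e n))\<close> the truncated expansion has error at most
  \<open>s\<^sub>n\<close>. Conversely \<open>n\<close> continuous functionals along the history of zeros have a common nonzero kernel
  vector in the span of \<open>e 0, \<dots>, e n\<close>, so the \<open>n\<close>th minimal worst case error is exactly \<open>s\<^sub>n\<close>.

  For the randomized lower bound, let \<open>m = 4 * n\<close> and average over the uniform distribution on the unit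
  ball of the span of \<open>e 0, \<dots>, e (m - 1)\<close>. For fixed \<open>\<omega>\<close>, once an adaptive algorithm has stopped after
  \<open>j\<close> observations, the input lies on an affine slice of dimension \<open>k \<ge> m - j\<close>. With
  \<open>q = 1 - (norm f)\<^sup>2\<close>, the mean squared error of a constant output on the slice is at least the mean of
  \<open>(k / 2) * q\<close>, by the divergence theorem. If \<open>16 * c * \<lambda> \<ge> m\<close>, then \<open>\<lambda> * j + c * q\<^sup>2\<close> makes up the
  missing \<open>((m - k) / 2) * q\<close> pointwise. Integrating over the slices, the average over the ball of squared
  error plus \<open>\<lambda>\<close> times cardinality plus \<open>c * q\<^sup>2\<close> dominates that of \<open>(m / 2) * q\<close>; the moments of
  \<open>q\<close> and a suitable choice of \<open>c\<close> and \<open>\<lambda>\<close> turn this into mean squared error at least \<open>1 / 4\<close>.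

  The values observed by an adaptive algorithm need not depend measurably on the input, so
  conditioning on them is avoided: only Tonelli's theorem along the observed functional is used, in
  coordinates obtained by a shear.\<close>

section \<open>Integration over affine slices\<close>

interpretation lborel_prod: product_sigma_finite "\<lambda>_. lborel :: real measure"
  by standard

abbreviation coord_lborel :: "nat set \<Rightarrow> (nat \<Rightarrow> real) measure" where
  "coord_lborel I \<equiv> PiM I (\<lambda>_. lborel)"

text \<open>A slice is carried by a base point and directions, so that integrals over it are product
  Lebesgue integrals over the coefficients. The directions need not be orthonormal; a change of
  directions only brings in a constant factor.\<close>

definition affine_param :: "'f::real_vector \<Rightarrow> (nat \<Rightarrow> 'f) \<Rightarrow> nat set \<Rightarrow> (nat \<Rightarrow> real) \<Rightarrow> 'f" where
  "affine_param a b I x = a + (\<Sum>i\<in>I. x i *\<^sub>R b i)"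

text \<open>Independence of the indexed family, not of its range: equal vectors at two indices count
  as dependent, so \<open>card I\<close> is the dimension of the slice.\<close>

definition indep_family :: "(nat \<Rightarrow> 'f::real_vector) \<Rightarrow> nat set \<Rightarrow> bool" where
  "indep_family b I \<longleftrightarrow> (\<forall>c. (\<Sum>i\<in>I. c i *\<^sub>R b i) = 0 \<longrightarrow> (\<forall>i\<in>I. c i = 0))"

text \<open>In a nonseparable space a sum of Borel maps may fail to be Borel. The map is therefore
  factored through real sequences, where product and Borel sigma-algebra agree, followed by a map
  that is continuous in the product topology.\<close>

lemma affine_param_measurable [measurable]:
  fixes a :: "'f::real_normed_vector"
  assumes "finite I"
  shows "affine_param a b I \<in> coord_lborel I \<rightarrow>\<^sub>M borel"
proof -
  define r :: "(nat \<Rightarrow> real) \<Rightarrow> nat \<Rightarrow> real" where "r = (\<lambda>x i. if i \<in> I then x i else 0)"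
  have "r \<in> coord_lborel I \<rightarrow>\<^sub>M PiM UNIV (\<lambda>_. borel)"
  proof (rule measurable_PiM_single')
    fix i :: nat
    show "(\<lambda>x. r x i) \<in> coord_lborel I \<rightarrow>\<^sub>M borel"
      by (cases "i \<in> I") (auto simp: r_def)
  qed auto
  then have r: "r \<in> borel_measurable (coord_lborel I)"
    using measurable_cong_sets[OF refl sets_PiM_equal_borel] by blast
  have "continuous_on UNIV (affine_param a b I)"
    unfolding affine_param_def by (intro continuous_intros continuous_on_product_coordinates)
  then have "affine_param a b I \<in> borel_measurable borel"
    by (rule borel_measurable_continuous_onI)
  with r have "(\<lambda>x. affine_param a b I (r x)) \<in> borel_measurable (coord_lborel I)"
    by (rule measurable_compose)
  moreover have "affine_param a b I (r x) = affine_param a b I x" for x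
    by (simp add: affine_param_def r_def)
  ultimately show ?thesis by simp
qed

lemma affine_param_insert_upd:
  assumes "finite I" "i \<notin> I"
  shows "affine_param a b (insert i I) (x(i := t)) = affine_param (a + t *\<^sub>R b i) b I x"
proof -
  have "(\<Sum>j\<in>I. (x(i := t)) j *\<^sub>R b j) = (\<Sum>j\<in>I. x j *\<^sub>R b j)"
    by (rule sum.cong) (use assms in auto)
  then show ?thesis using assms by (simp add: affine_param_def algebra_simps)
qed

lemma linear_affine_param:
  assumes "linear l"
  shows "l (affine_param a b I x) = l a + (\<Sum>i\<in>I. x i * l (b i))"
  using assms by (simp add: affine_param_def linear_add linear_sum linear_cmul)

section \<open>Shears that turn a functional into a coordinate\<close>

definition shear_base :: "('f::real_vector \<Rightarrow> real) \<Rightarrow> nat \<Rightarrow> (nat \<Rightarrow> 'f) \<Rightarrow> 'f \<Rightarrow> 'f" where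
  "shear_base l i b a = a - (l a / l (b i)) *\<^sub>R b i"

text \<open>The other directions are pushed along \<open>b i\<close> into the kernel of
  \<open>l\<close>, and \<open>b i\<close> is scaled to \<open>l\<close>-value 1. With the base
  point \<open>shear_base\<close> in the kernel as well, coordinate \<open>i\<close> becomes the
  value of \<open>l\<close>.\<close>

definition shear_dirs :: "('f::real_vector \<Rightarrow> real) \<Rightarrow> nat \<Rightarrow> (nat \<Rightarrow> 'f) \<Rightarrow> nat \<Rightarrow> 'f" where
  "shear_dirs l i b = (\<lambda>j. if j = i then (1 / l (b i)) *\<^sub>R b i else b j - (l (b j) / l (b i)) *\<^sub>R b i)"

lemma shear_zero:
  assumes "linear l" "l (b i) \<noteq> 0"
  shows "l (shear_base l i b a) = 0" "j \<noteq> i \<Longrightarrow> l (shear_dirs l i b j) = 0" "l (shear_dirs l i b i) = 1"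
  using assms by (simp_all add: shear_base_def shear_dirs_def linear_diff linear_cmul)

text \<open>A relation among the sheared directions unfolds into one among the original directions
  that keeps all coefficients and only adds one at \<open>i\<close>.\<close>

lemma indep_shear:
  assumes b: "indep_family b (insert i I)" and I: "finite I" "i \<notin> I"
  shows "indep_family (shear_dirs l i b) I"
  unfolding indep_family_def
proof (intro allI impI)
  fix c assume c: "(\<Sum>j\<in>I. c j *\<^sub>R shear_dirs l i b j) = 0"
  define d where "d = c(i := - (\<Sum>j\<in>I. c j * (l (b j) / l (b i))))"
  have "(\<Sum>j\<in>I. c j *\<^sub>R shear_dirs l i b j) = (\<Sum>j\<in>I. c j *\<^sub>R b j - (c j * (l (b j) / l (b i))) *\<^sub>R b i)"
    by (rule sum.cong) (use I in \<open>auto simp: shear_dirs_def algebra_simps\<close>)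
  also have "\<dots> = (\<Sum>j\<in>I. c j *\<^sub>R b j) - (\<Sum>j\<in>I. c j * (l (b j) / l (b i))) *\<^sub>R b i"
    by (simp add: sum_subtractf scaleR_sum_left)
  also have "\<dots> = (\<Sum>j\<in>insert i I. d j *\<^sub>R b j)"
  proof -
    have "(\<Sum>j\<in>I. d j *\<^sub>R b j) = (\<Sum>j\<in>I. c j *\<^sub>R b j)"
      by (rule sum.cong) (use I in \<open>auto simp: d_def\<close>)
    then show ?thesis using I by (simp add: d_def)
  qed
  finally have "(\<Sum>j\<in>insert i I. d j *\<^sub>R b j) = 0" using c by simp
  then have "\<forall>j\<in>insert i I. d j = 0" using b unfolding indep_family_def by blast
  then show "\<forall>j\<in>I. c j = 0" using I by (auto simp: d_def split: if_splits)
qed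

text \<open>With the other coordinates fixed, the point of \<open>l\<close>-value \<open>t\<close>
  is found by solving for the coefficient of \<open>b i\<close>. This is an affine substitution of
  slope \<open>1 / l (b i)\<close>.\<close>

lemma affine_param_shear:
  assumes I: "finite I" "i \<notin> I"
  shows "affine_param (shear_base l i b a) (shear_dirs l i b) (insert i I) (x(i := t)) =
    affine_param a b (insert i I) (x(i := (t - l a - (\<Sum>j\<in>I. x j * l (b j))) / l (b i)))"
proof -
  have "(\<Sum>j\<in>I. x j *\<^sub>R shear_dirs l i b j) = (\<Sum>j\<in>I. x j *\<^sub>R b j - (x j * l (b j) / l (b i)) *\<^sub>R b i)"
    by (rule sum.cong) (use I in \<open>auto simp: shear_dirs_def algebra_simps\<close>)
  also have "\<dots> = (\<Sum>j\<in>I. x j *\<^sub>R b j) - ((\<Sum>j\<in>I. x j * l (b j)) / l (b i)) *\<^sub>R b i"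
    by (simp add: sum_subtractf scaleR_sum_left sum_divide_distrib)
  finally have sum: "(\<Sum>j\<in>I. x j *\<^sub>R shear_dirs l i b j) = \<dots>" .
  have dir: "shear_dirs l i b i = (1 / l (b i)) *\<^sub>R b i"
    by (simp add: shear_dirs_def)
  show ?thesis
    unfolding affine_param_insert_upd[OF I] unfolding affine_param_def shear_base_def sum dir
    by (simp add: algebra_simps diff_divide_distrib add_divide_distrib)
qed

text \<open>On each line in direction \<open>b i\<close> the substitution has the same slope, so the
  Jacobian is constant. Only the values of \<open>l\<close> at the base point and at finitely many
  directions enter, so \<open>l\<close> may be discontinuous.\<close>

lemma nn_integral_shear:
  fixes a :: "'f::real_normed_vector"
  assumes I: "finite I" "i \<notin> I" and l: "linear l" "l (b i) \<noteq> 0"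
    and G [measurable]: "G \<in> borel_measurable borel"
  shows "(\<integral>\<^sup>+x. G (affine_param a b (insert i I) x) \<partial>coord_lborel (insert i I)) =
    ennreal \<bar>1 / l (b i)\<bar> *
    (\<integral>\<^sup>+x. G (affine_param (shear_base l i b a) (shear_dirs l i b) (insert i I) x) \<partial>coord_lborel (insert i I))"
proof -
  let ?a = "shear_base l i b a" and ?b = "shear_dirs l i b" and ?c = "1 / l (b i)"
  have fin: "finite (insert i I)" using I by simp
  note [measurable] = affine_param_measurable[OF fin]
  have m1: "(\<lambda>x. G (affine_param a b (insert i I) x)) \<in> borel_measurable (coord_lborel (insert i I))" for a b
    by measurable
  have line: "(\<lambda>y. G (p + y *\<^sub>R w)) \<in> borel_measurable borel" for p w
    by (rule measurable_compose[OF borel_measurable_continuous_onI G]) (intro continuous_intros)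
  have inner: "(\<integral>\<^sup>+y. G (affine_param a b (insert i I) (x(i := y))) \<partial>lborel) =
      ennreal \<bar>?c\<bar> * (\<integral>\<^sup>+t. G (affine_param ?a ?b (insert i I) (x(i := t))) \<partial>lborel)" for x
  proof -
    define s where "s = (- l a - (\<Sum>j\<in>I. x j * l (b j))) / l (b i)"
    let ?p = "a + (\<Sum>j\<in>I. x j *\<^sub>R b j)"
    have 1: "affine_param a b (insert i I) (x(i := y)) = ?p + y *\<^sub>R b i" for y
      by (simp add: affine_param_insert_upd[OF I]) (simp add: affine_param_def)
    have 2: "affine_param ?a ?b (insert i I) (x(i := t)) = ?p + (s + ?c * t) *\<^sub>R b i" for t
      unfolding affine_param_shear[OF I] 1 s_def by (simp add: add_divide_distrib diff_divide_distrib)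
    have "(\<integral>\<^sup>+y. G (?p + y *\<^sub>R b i) \<partial>lborel) = \<bar>?c\<bar> * (\<integral>\<^sup>+t. G (?p + (s + ?c * t) *\<^sub>R b i) \<partial>lborel)"
      by (rule nn_integral_real_affine[OF line]) (use l in simp)
    then show ?thesis unfolding 1 2 .
  qed
  have "(\<integral>\<^sup>+x. G (affine_param a b (insert i I) x) \<partial>coord_lborel (insert i I)) =
      (\<integral>\<^sup>+x. (\<integral>\<^sup>+y. G (affine_param a b (insert i I) (x(i := y))) \<partial>lborel) \<partial>coord_lborel I)"
    by (rule lborel_prod.product_nn_integral_insert[OF I m1])
  also have "\<dots> = (\<integral>\<^sup>+x. ennreal \<bar>?c\<bar> * (\<integral>\<^sup>+t. G (affine_param ?a ?b (insert i I) (x(i := t))) \<partial>lborel) \<partial>coord_lborel I)"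
    by (simp only: inner)
  also have "\<dots> = ennreal \<bar>?c\<bar> * (\<integral>\<^sup>+x. (\<integral>\<^sup>+t. G (affine_param ?a ?b (insert i I) (x(i := t))) \<partial>lborel) \<partial>coord_lborel I)"
  proof (rule nn_integral_cmult)
    have "(\<lambda>(x, t). x(i := t)) \<in> coord_lborel I \<Otimes>\<^sub>M lborel \<rightarrow>\<^sub>M coord_lborel (insert i I)"
      using measurable_add_dim[of i I "\<lambda>_. lborel :: real measure"] by simp
    from measurable_compose[OF this m1]
    show "(\<lambda>x. \<integral>\<^sup>+t. G (affine_param ?a ?b (insert i I) (x(i := t))) \<partial>lborel) \<in> borel_measurable (coord_lborel I)"
      by (intro lborel.borel_measurable_nn_integral) (simp add: case_prod_beta')
  qed
  also have "\<dots> = ennreal \<bar>?c\<bar> * (\<integral>\<^sup>+x. G (affine_param ?a ?b (insert i I) x) \<partial>coord_lborel (insert i I))"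
    by (simp only: lborel_prod.product_nn_integral_insert[OF I m1])
  finally show ?thesis .
qed

text \<open>Tonelli in both orders: with coordinate \<open>i\<close> outside, the inner integral
  runs over a slice of one dimension less; with it inside, over a line.\<close>

lemma nn_integral_slices:
  fixes a :: "'f::real_normed_vector"
  assumes I: "finite I" "i \<notin> I"
    and G [measurable]: "G \<in> borel_measurable borel"
  shows "(\<integral>\<^sup>+x. G (affine_param a b (insert i I) x) \<partial>coord_lborel (insert i I)) =
      (\<integral>\<^sup>+t. (\<integral>\<^sup>+x. G (affine_param (a + t *\<^sub>R b i) b I x) \<partial>coord_lborel I) \<partial>lborel)" (is ?A)
    and "(\<integral>\<^sup>+x. G (affine_param a b (insert i I) x) \<partial>coord_lborel (insert i I)) =
      (\<integral>\<^sup>+x. (\<integral>\<^sup>+t. G (affine_param (a + t *\<^sub>R b i) b I x) \<partial>lborel) \<partial>coord_lborel I)" (is ?B)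
proof -
  have fin: "finite (insert i I)" using I by simp
  note [measurable] = affine_param_measurable[OF fin]
  have m: "(\<lambda>x. G (affine_param a b (insert i I) x)) \<in> borel_measurable (coord_lborel (insert i I))"
    by measurable
  show ?A
    by (simp only: lborel_prod.product_nn_integral_insert_rev[OF I m] affine_param_insert_upd[OF I])
  show ?B
    by (simp only: lborel_prod.product_nn_integral_insert[OF I m] affine_param_insert_upd[OF I])
qed

section \<open>Moments along a line\<close>

lemma nn_integral_symmetric_interval:
  fixes s :: real
  assumes f: "f \<in> borel_measurable borel" and F: "\<And>x. DERIV F x :> f x"
    and nn: "\<And>x. x\<^sup>2 \<le> s \<Longrightarrow> 0 \<le> f x" and s: "0 \<le> s"
  shows "(\<integral>\<^sup>+t. ennreal (f t) * indicator {t. t\<^sup>2 < s} t \<partial>lborel) = ennreal (F (sqrt s) - F (- sqrt s))"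
proof -
  have abs: "t\<^sup>2 < s \<longleftrightarrow> \<bar>t\<bar> < sqrt s" "t\<^sup>2 \<le> s \<longleftrightarrow> \<bar>t\<bar> \<le> sqrt s" for t
    by (metis real_sqrt_abs real_sqrt_less_iff, metis real_sqrt_abs real_sqrt_le_iff)
  have iff: "t\<^sup>2 < s \<longleftrightarrow> - sqrt s < t \<and> t < sqrt s" "t\<^sup>2 \<le> s \<longleftrightarrow> - sqrt s \<le> t \<and> t \<le> sqrt s" for t
    unfolding abs by linarith+
  have "(\<integral>\<^sup>+t. ennreal (f t) * indicator {t. t\<^sup>2 < s} t \<partial>lborel) =
      (\<integral>\<^sup>+t. ennreal (f t) * indicator {- sqrt s .. sqrt s} t \<partial>lborel)"
  proof (rule nn_integral_cong_AE)
    have "AE t in lborel. t \<noteq> sqrt s" "AE t in lborel. t \<noteq> - sqrt s"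
      by (rule AE_lborel_singleton)+
    then show "AE t in lborel. ennreal (f t) * indicator {t. t\<^sup>2 < s} t = ennreal (f t) * indicator {- sqrt s .. sqrt s} t"
      by eventually_elim (auto simp: iff indicator_def)
  qed
  also have "\<dots> = F (sqrt s) - F (- sqrt s)"
    by (rule nn_integral_FTC_Icc) (use f F nn s in \<open>auto simp: iff\<close>)
  finally show ?thesis .
qed

lemma nn_integral_truncated_power:
  fixes s :: real
  assumes "0 < s" "p > 0"
  shows "(\<integral>\<^sup>+t. ennreal (c * max 0 (s - t\<^sup>2) ^ p) \<partial>lborel) =
    (\<integral>\<^sup>+t. ennreal (c * (s - t\<^sup>2) ^ p) * indicator {t. t\<^sup>2 < s} t \<partial>lborel)"
  by (rule nn_integral_cong) (use assms in \<open>auto simp: indicator_def max_def zero_power\<close>)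

text \<open>About the midpoint there is equality, by integration by parts: \<open>- t\<close> is the
  derivative of \<open>(s - t^2) / 2\<close>, which vanishes at both ends. Moving the centre to
  \<open>\<alpha>\<close> adds \<open>2 * w * \<alpha>^2\<close>, where
  \<open>w = sqrt s\<close>.\<close>

lemma line_second_moment:
  fixes s \<alpha> :: real
  shows "(\<integral>\<^sup>+t. ennreal (1 / 2 * max 0 (s - t\<^sup>2)) \<partial>lborel) \<le>
    (\<integral>\<^sup>+t. ennreal ((t - \<alpha>)\<^sup>2) * indicator {t. t\<^sup>2 < s} t \<partial>lborel)"
proof (cases "0 < s")
  case True
  define w where "w = sqrt s"
  have w: "w > 0" "s = w\<^sup>2" using True by (auto simp: w_def)
  have "(\<integral>\<^sup>+t. ennreal (1 / 2 * max 0 (s - t\<^sup>2)) \<partial>lborel) =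
      (\<integral>\<^sup>+t. ennreal (1 / 2 * (s - t\<^sup>2)) * indicator {t. t\<^sup>2 < s} t \<partial>lborel)"
    using nn_integral_truncated_power[OF True, of 1 "1/2"] by simp
  also have "\<dots> = ennreal ((s * w - w ^ 3 / 3) / 2 - (s * (- w) - (- w) ^ 3 / 3) / 2)"
    unfolding w_def
    by (rule nn_integral_symmetric_interval[where F = "\<lambda>t. (s * t - t ^ 3 / 3) / 2"])
       (use True in \<open>auto intro!: derivative_eq_intros simp: power2_eq_square\<close>)
  also have "\<dots> \<le> ennreal ((w - \<alpha>) ^ 3 / 3 - (- w - \<alpha>) ^ 3 / 3)"
  proof (rule ennreal_leI)
    have "(w - \<alpha>) ^ 3 / 3 - (- w - \<alpha>) ^ 3 / 3 - ((s * w - w ^ 3 / 3) / 2 - (s * (- w) - (- w) ^ 3 / 3) / 2) = 2 * w * \<alpha>\<^sup>2"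
      unfolding w by (simp add: power2_eq_square power3_eq_cube field_simps)
    moreover have "0 \<le> 2 * w * \<alpha>\<^sup>2" using w by simp
    ultimately show "(s * w - w ^ 3 / 3) / 2 - (s * (- w) - (- w) ^ 3 / 3) / 2 \<le> (w - \<alpha>) ^ 3 / 3 - (- w - \<alpha>) ^ 3 / 3"
      by linarith
  qed
  also have "\<dots> = (\<integral>\<^sup>+t. ennreal ((t - \<alpha>)\<^sup>2) * indicator {t. t\<^sup>2 < s} t \<partial>lborel)"
    unfolding w_def
    by (rule nn_integral_symmetric_interval[symmetric])
       (use True in \<open>auto intro!: derivative_eq_intros\<close>)
  finally show ?thesis .
next
  case False
  then have "max 0 (s - t\<^sup>2) = 0" for t by (simp add: max_def) (smt (verit) zero_le_power2)
  then show ?thesis by simp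
qed

text \<open>Integration by parts again, since \<open>(s - t^2) ^ p\<close> has derivative
  \<open>- 2 * p * t * (s - t^2) ^ (p - 1)\<close>. Explicit antiderivatives settle the two
  exponents that the ball moments call for.\<close>

lemma line_weighted_second_moment:
  fixes s :: real
  assumes p: "p = 1 \<or> p = 2"
  shows "(\<integral>\<^sup>+t. ennreal (t\<^sup>2 * max 0 (s - t\<^sup>2) ^ (p - 1)) * indicator {t. t\<^sup>2 < s} t \<partial>lborel) =
    (\<integral>\<^sup>+t. ennreal (1 / (2 * real p) * max 0 (s - t\<^sup>2) ^ p) \<partial>lborel)"
proof (cases "0 < s")
  case True
  define w where "w = sqrt s"
  have w: "w > 0" "s = w\<^sup>2" using True by (auto simp: w_def)
  have "(\<integral>\<^sup>+t. ennreal (t\<^sup>2 * max 0 (s - t\<^sup>2) ^ (p - 1)) * indicator {t. t\<^sup>2 < s} t \<partial>lborel) =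
      (\<integral>\<^sup>+t. ennreal (t\<^sup>2 * (s - t\<^sup>2) ^ (p - 1)) * indicator {t. t\<^sup>2 < s} t \<partial>lborel)"
    by (rule nn_integral_cong) (auto simp: indicator_def max_def)
  moreover have "(\<integral>\<^sup>+t. ennreal (1 / (2 * real p) * max 0 (s - t\<^sup>2) ^ p) \<partial>lborel) =
      (\<integral>\<^sup>+t. ennreal (1 / (2 * real p) * (s - t\<^sup>2) ^ p) * indicator {t. t\<^sup>2 < s} t \<partial>lborel)"
    using p by (intro nn_integral_truncated_power[OF True]) auto
  moreover have "(\<integral>\<^sup>+t. ennreal (t\<^sup>2 * (s - t\<^sup>2) ^ (p - 1)) * indicator {t. t\<^sup>2 < s} t \<partial>lborel) =
      (\<integral>\<^sup>+t. ennreal (1 / (2 * real p) * (s - t\<^sup>2) ^ p) * indicator {t. t\<^sup>2 < s} t \<partial>lborel)"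
    using p
  proof
    assume p: "p = 1"
    have "(\<integral>\<^sup>+t. ennreal (t\<^sup>2) * indicator {t. t\<^sup>2 < s} t \<partial>lborel) = ennreal (w ^ 3 / 3 - (- w) ^ 3 / 3)"
      unfolding w_def by (rule nn_integral_symmetric_interval)
         (use True in \<open>auto intro!: derivative_eq_intros\<close>)
    moreover have "(\<integral>\<^sup>+t. ennreal (1 / 2 * (s - t\<^sup>2)) * indicator {t. t\<^sup>2 < s} t \<partial>lborel) =
        ennreal ((s * w - w ^ 3 / 3) / 2 - (s * (- w) - (- w) ^ 3 / 3) / 2)"
      unfolding w_def
      by (rule nn_integral_symmetric_interval[where F = "\<lambda>t. (s * t - t ^ 3 / 3) / 2"])
         (use True in \<open>auto intro!: derivative_eq_intros simp: power2_eq_square\<close>)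
    moreover have "(s * w - w ^ 3 / 3) / 2 - (s * (- w) - (- w) ^ 3 / 3) / 2 = w ^ 3 / 3 - (- w) ^ 3 / 3"
      unfolding w by (simp add: power2_eq_square power3_eq_cube field_simps)
    ultimately have "(\<integral>\<^sup>+t. ennreal (t\<^sup>2) * indicator {t. t\<^sup>2 < s} t \<partial>lborel) =
        (\<integral>\<^sup>+t. ennreal (1 / 2 * (s - t\<^sup>2)) * indicator {t. t\<^sup>2 < s} t \<partial>lborel)"
      by (simp only:)
    then show ?thesis unfolding p by simp
  next
    assume p: "p = 2"
    have "(\<integral>\<^sup>+t. ennreal (t\<^sup>2 * (s - t\<^sup>2)) * indicator {t. t\<^sup>2 < s} t \<partial>lborel) =
        ennreal ((s * w ^ 3 / 3 - w ^ 5 / 5) - (s * (- w) ^ 3 / 3 - (- w) ^ 5 / 5))"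
      unfolding w_def
    proof (rule nn_integral_symmetric_interval[where F = "\<lambda>t. s * t ^ 3 / 3 - t ^ 5 / 5"])
      show "((\<lambda>t. s * t ^ 3 / 3 - t ^ 5 / 5) has_real_derivative x\<^sup>2 * (s - x\<^sup>2)) (at x)" for x
        by (auto intro!: derivative_eq_intros simp: power_numeral_reduce field_simps)
    qed (use True in auto)
    moreover have "(\<integral>\<^sup>+t. ennreal (1 / 4 * (s - t\<^sup>2) ^ 2) * indicator {t. t\<^sup>2 < s} t \<partial>lborel) =
        ennreal ((s\<^sup>2 * w - 2 * s * w ^ 3 / 3 + w ^ 5 / 5) / 4 - (s\<^sup>2 * (- w) - 2 * s * (- w) ^ 3 / 3 + (- w) ^ 5 / 5) / 4)"
      unfolding w_def
    proof (rule nn_integral_symmetric_interval[where F = "\<lambda>t. (s\<^sup>2 * t - 2 * s * t ^ 3 / 3 + t ^ 5 / 5) / 4"])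
      show "((\<lambda>t. (s\<^sup>2 * t - 2 * s * t ^ 3 / 3 + t ^ 5 / 5) / 4) has_real_derivative 1 / 4 * (s - x\<^sup>2)\<^sup>2) (at x)" for x
        by (auto intro!: derivative_eq_intros simp: power_numeral_reduce field_simps)
    qed (use True in auto)
    moreover have "(s * w ^ 3 / 3 - w ^ 5 / 5) - (s * (- w) ^ 3 / 3 - (- w) ^ 5 / 5) =
        (s\<^sup>2 * w - 2 * s * w ^ 3 / 3 + w ^ 5 / 5) / 4 - (s\<^sup>2 * (- w) - 2 * s * (- w) ^ 3 / 3 + (- w) ^ 5 / 5) / 4"
      unfolding w by (simp add: power_numeral_reduce field_simps)
    ultimately show ?thesis unfolding p by simp
  qed
  ultimately show ?thesis by simp
next
  case False
  then have "\<not> t\<^sup>2 < s" "max 0 (s - t\<^sup>2) = 0" for t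
    by (simp_all add: max_def) (smt (verit) zero_le_power2)+
  then show ?thesis using p by auto
qed

section \<open>Second moments on slices of a ball\<close>

lemma norm_orthogonal_line:
  fixes g w A :: "'f::real_inner"
  assumes "inner g w = 0" "norm w = 1"
  shows "(norm (g + t *\<^sub>R w - A))\<^sup>2 = (norm (g - (A - inner A w *\<^sub>R w)))\<^sup>2 + (t - inner A w)\<^sup>2"
    and "(norm (g + t *\<^sub>R w))\<^sup>2 = (norm g)\<^sup>2 + t\<^sup>2"
proof -
  have w: "inner w w = 1" using assms by (simp add: power2_norm_eq_inner[symmetric])
  have *: "inner w g = 0" using assms by (simp add: inner_commute)
  show "(norm (g + t *\<^sub>R w - A))\<^sup>2 = (norm (g - (A - inner A w *\<^sub>R w)))\<^sup>2 + (t - inner A w)\<^sup>2"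
    unfolding power2_norm_eq_inner
    by (simp add: inner_add_left inner_add_right inner_diff_left inner_diff_right w assms(1) *
        inner_commute[of w A] inner_commute[of A g] power2_eq_square algebra_simps)
  show "(norm (g + t *\<^sub>R w))\<^sup>2 = (norm g)\<^sup>2 + t\<^sup>2"
    unfolding power2_norm_eq_inner
    by (simp add: inner_add_left inner_add_right w assms(1) * power2_eq_square)
qed

lemma affine_param_add:
  "affine_param (a + v) b I x = affine_param a b I x + v"
  by (simp add: affine_param_def)

text \<open>A shear along this functional is a Gram-Schmidt step: it normalises \<open>b i\<close>
  and makes the base point and the other directions orthogonal to it.\<close>

definition unit_functional :: "'f::real_inner \<Rightarrow> 'f \<Rightarrow> real" where
  "unit_functional v f = inner f v / norm v"

lemma linear_unit_functional: "linear (unit_functional v)"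
  by (rule linearI) (simp_all add: unit_functional_def inner_add_left add_divide_distrib)

lemma unit_functional_self: "v \<noteq> 0 \<Longrightarrow> unit_functional v v = norm v"
  by (simp add: unit_functional_def power2_norm_eq_inner[symmetric] power2_eq_square)

lemma unit_shear:
  fixes a :: "'f::real_inner"
  assumes "b i \<noteq> 0" "i \<notin> I"
  defines "w \<equiv> shear_dirs (unit_functional (b i)) i b i"
  shows "norm w = 1"
    and "inner (affine_param (shear_base (unit_functional (b i)) i b a) (shear_dirs (unit_functional (b i)) i b) I x) w = 0"
proof -
  let ?l = "unit_functional (b i)"
  have l: "linear ?l" "?l (b i) \<noteq> 0"
    using assms by (simp_all add: linear_unit_functional unit_functional_self)
  have w: "w = (1 / norm (b i)) *\<^sub>R b i"
    using assms by (simp add: w_def shear_dirs_def unit_functional_self)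
  show "norm w = 1" unfolding w using assms(1) by simp
  have "(\<Sum>j\<in>I. x j * ?l (shear_dirs ?l i b j)) = 0"
  proof (intro sum.neutral ballI)
    fix j assume "j \<in> I"
    then have "j \<noteq> i" using assms(2) by auto
    then show "x j * ?l (shear_dirs ?l i b j) = 0" using shear_zero(2)[of ?l b i j] l by simp
  qed
  then have "?l (affine_param (shear_base ?l i b a) (shear_dirs ?l i b) I x) = 0"
    by (simp add: linear_affine_param[OF l(1)] shear_zero(1)[of ?l b i, OF l])
  then show "inner (affine_param (shear_base ?l i b a) (shear_dirs ?l i b) I x) w = 0"
    by (simp add: w unit_functional_def)
qed

text \<open>Induction by Gram-Schmidt. The squared distance to \<open>A\<close> splits into the part
  orthogonal to a unit direction \<open>w\<close> and the part along \<open>w\<close>. The first is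
  bounded by the induction hypothesis, the second by the estimate on lines, and the factors
  \<open>card I / 2\<close> and \<open>1 / 2\<close> add up. \<open>R\<close> and \<open>A\<close>
  vary because both change when the coordinate along \<open>w\<close> is split off.\<close>

lemma slice_second_moment:
  fixes a :: "'f::real_inner"
  assumes "finite I" "indep_family b I"
  shows "(\<integral>\<^sup>+x. ennreal (real (card I) / 2 * max 0 (R - (norm (affine_param a b I x))\<^sup>2)) \<partial>coord_lborel I) \<le>
    (\<integral>\<^sup>+x. ennreal ((norm (affine_param a b I x - A))\<^sup>2) *
      indicator {f. (norm f)\<^sup>2 < R} (affine_param a b I x) \<partial>coord_lborel I)"
  using assms
proof (induction I arbitrary: a b A R rule: finite_induct)
  case empty
  then show ?case by simp
next
  case (insert i I)
  let ?l = "unit_functional (b i)"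
  let ?a = "shear_base ?l i b a" and ?b = "shear_dirs ?l i b"
  define w where "w = ?b i"
  define A' where "A' = A - inner A w *\<^sub>R w"
  define k where "k = real (card I)"
  have fin: "finite (insert i I)" and i: "i \<notin> I" using insert by auto
  have bi: "b i \<noteq> 0"
  proof
    assume "b i = 0"
    then have "(\<Sum>j\<in>insert i I. (if j = i then 1 else 0) *\<^sub>R b j) = 0"
      by (intro sum.neutral) auto
    with insert.prems have "\<forall>j\<in>insert i I. (if j = i then 1 else 0) = (0::real)"
      unfolding indep_family_def by fast
    then show False by simp
  qed
  have l: "linear ?l" "?l (b i) \<noteq> 0"
    using bi by (simp_all add: linear_unit_functional unit_functional_self)
  note ortho = unit_shear[of b i I, OF bi i, folded w_def]
  have indep: "indep_family ?b I" by (rule indep_shear) (use insert in auto)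
  note [measurable] = affine_param_measurable[OF insert.hyps(1)] affine_param_measurable[OF fin]
  have ball [measurable]: "{f::'f. (norm f)\<^sup>2 < R} \<in> sets borel" for R
    by (intro borel_open open_Collect_less continuous_intros)
  have cont: "continuous_on UNIV F \<Longrightarrow> (\<lambda>f. ennreal (F f)) \<in> borel_measurable borel" for F :: "'f \<Rightarrow> real"
    by (rule measurable_compose[OF borel_measurable_continuous_onI measurable_ennreal])
  \<comment> \<open>The parameter \<open>c\<close> counts the directions accounted for.
    \<open>Ga\<close> and \<open>Gb\<close> are the parts of \<open>G2\<close> orthogonal to
    \<open>w\<close> and along \<open>w\<close>.\<close>
  define G1 :: "real \<Rightarrow> 'f \<Rightarrow> ennreal" where "G1 = (\<lambda>c f. ennreal (c / 2 * max 0 (R - (norm f)\<^sup>2)))"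
  define G2 :: "'f \<Rightarrow> ennreal" where
    "G2 = (\<lambda>f. ennreal ((norm (f - A))\<^sup>2) * indicator {f. (norm f)\<^sup>2 < R} f)"
  define Ga :: "'f \<Rightarrow> ennreal" where
    "Ga = (\<lambda>f. ennreal ((norm (f - inner f w *\<^sub>R w - A'))\<^sup>2) * indicator {f. (norm f)\<^sup>2 < R} f)"
  define Gb :: "'f \<Rightarrow> ennreal" where
    "Gb = (\<lambda>f. ennreal ((inner f w - inner A w)\<^sup>2) * indicator {f. (norm f)\<^sup>2 < R} f)"
  have [measurable]: "G1 c \<in> borel_measurable borel" for c
    unfolding G1_def by (rule cont) (intro continuous_intros)
  have [measurable]: "G2 \<in> borel_measurable borel"
    unfolding G2_def by (intro borel_measurable_times_ennreal borel_measurable_indicator ball cont continuous_intros)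
  have [measurable]: "Ga \<in> borel_measurable borel"
    unfolding Ga_def by (intro borel_measurable_times_ennreal borel_measurable_indicator ball cont continuous_intros)
  have [measurable]: "Gb \<in> borel_measurable borel"
    unfolding Gb_def by (intro borel_measurable_times_ennreal borel_measurable_indicator ball cont continuous_intros)
  define N where "N G = (\<integral>\<^sup>+x. G (affine_param ?a ?b (insert i I) x) \<partial>coord_lborel (insert i I))"
    for G :: "'f \<Rightarrow> ennreal"
  define g where "g = affine_param ?a ?b I"
  have g: "inner (g x) w = 0" for x unfolding g_def by (rule ortho)
  have split: "(norm (g x + t *\<^sub>R w))\<^sup>2 = (norm (g x))\<^sup>2 + t\<^sup>2" for x t
    by (rule norm_orthogonal_line(2)[OF g ortho(1)])
  have coord: "inner (g x + t *\<^sub>R w) w = t" for x t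
    using g[of x] ortho(1) by (simp add: inner_add_left power2_norm_eq_inner[symmetric])
  have slice: "affine_param (?a + t *\<^sub>R ?b i) ?b I x = g x + t *\<^sub>R w" for t x
    by (simp add: affine_param_add g_def w_def)
  have [measurable]: "g \<in> coord_lborel I \<rightarrow>\<^sub>M borel" unfolding g_def by measurable
  \<comment> \<open>For a fixed coordinate \<open>t\<close> along \<open>w\<close> the ball cuts out
    squared radius \<open>R - t^2\<close>, to which the induction hypothesis applies.\<close>
  have "N (G1 k) \<le> N Ga"
    unfolding N_def
  proof (subst (1 2) nn_integral_slices(1)[OF insert.hyps(1,2)])
    show "(\<integral>\<^sup>+t. \<integral>\<^sup>+x. G1 k (affine_param (?a + t *\<^sub>R ?b i) ?b I x) \<partial>coord_lborel I \<partial>lborel)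
        \<le> (\<integral>\<^sup>+t. \<integral>\<^sup>+x. Ga (affine_param (?a + t *\<^sub>R ?b i) ?b I x) \<partial>coord_lborel I \<partial>lborel)"
    proof (rule nn_integral_mono, unfold slice)
      fix t
      have "(\<integral>\<^sup>+x. G1 k (g x + t *\<^sub>R w) \<partial>coord_lborel I) =
          (\<integral>\<^sup>+x. ennreal (k / 2 * max 0 ((R - t\<^sup>2) - (norm (g x))\<^sup>2)) \<partial>coord_lborel I)"
        unfolding G1_def split by (simp add: algebra_simps)
      also have "\<dots> \<le> (\<integral>\<^sup>+x. ennreal ((norm (g x - A'))\<^sup>2) *
          indicator {f. (norm f)\<^sup>2 < R - t\<^sup>2} (g x) \<partial>coord_lborel I)"
        unfolding g_def k_def by (rule insert.IH[OF indep])
      also have "\<dots> = (\<integral>\<^sup>+x. Ga (g x + t *\<^sub>R w) \<partial>coord_lborel I)"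
        unfolding Ga_def coord indicator_def by (intro nn_integral_cong) (auto simp: split algebra_simps)
      finally show "(\<integral>\<^sup>+x. G1 k (g x + t *\<^sub>R w) \<partial>coord_lborel I) \<le> (\<integral>\<^sup>+x. Ga (g x + t *\<^sub>R w) \<partial>coord_lborel I)" .
    qed
  qed measurable
  \<comment> \<open>With the roles exchanged, the component orthogonal to \<open>w\<close> is fixed
    and the ball cuts out an interval on the line.\<close>
  moreover have "N (G1 1) \<le> N Gb"
    unfolding N_def
  proof (subst (1 2) nn_integral_slices(2)[OF insert.hyps(1,2)])
    show "(\<integral>\<^sup>+x. \<integral>\<^sup>+t. G1 1 (affine_param (?a + t *\<^sub>R ?b i) ?b I x) \<partial>lborel \<partial>coord_lborel I)
        \<le> (\<integral>\<^sup>+x. \<integral>\<^sup>+t. Gb (affine_param (?a + t *\<^sub>R ?b i) ?b I x) \<partial>lborel \<partial>coord_lborel I)"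
    proof (rule nn_integral_mono, unfold slice)
      fix x
      have "(\<integral>\<^sup>+t. G1 1 (g x + t *\<^sub>R w) \<partial>lborel) =
          (\<integral>\<^sup>+t. ennreal (1 / 2 * max 0 ((R - (norm (g x))\<^sup>2) - t\<^sup>2)) \<partial>lborel)"
        unfolding G1_def split by (simp add: algebra_simps)
      also have "\<dots> \<le> (\<integral>\<^sup>+t. ennreal ((t - inner A w)\<^sup>2) *
          indicator {t. t\<^sup>2 < R - (norm (g x))\<^sup>2} t \<partial>lborel)"
        by (rule line_second_moment)
      also have "\<dots> = (\<integral>\<^sup>+t. Gb (g x + t *\<^sub>R w) \<partial>lborel)"
        unfolding Gb_def coord indicator_def by (intro nn_integral_cong) (auto simp: split algebra_simps)
      finally show "(\<integral>\<^sup>+t. G1 1 (g x + t *\<^sub>R w) \<partial>lborel) \<le> (\<integral>\<^sup>+t. Gb (g x + t *\<^sub>R w) \<partial>lborel)" .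
    qed
  qed measurable
  moreover have "N (G1 (real (card (insert i I)))) = N (G1 k) + N (G1 1)"
  proof -
    have "G1 (real (card (insert i I))) f = G1 k f + G1 1 f" for f
      using insert.hyps unfolding G1_def k_def
      by (subst ennreal_plus[symmetric]) (auto simp: algebra_simps add_divide_distrib)
    then show ?thesis unfolding N_def
      by (simp only: nn_integral_add) (subst nn_integral_add, measurable)
  qed
  moreover have "N Ga + N Gb = N G2"
  proof -
    have dec: "\<exists>y t. affine_param ?a ?b (insert i I) x = g y + t *\<^sub>R w" for x
      using affine_param_insert_upd[OF insert.hyps(1,2), of ?a ?b x "x i"] slice by auto
    have "Ga (g y + t *\<^sub>R w) + Gb (g y + t *\<^sub>R w) = G2 (g y + t *\<^sub>R w)" for y t
      unfolding Ga_def Gb_def G2_def coord norm_orthogonal_line(1)[OF g ortho(1)] A'_def[symmetric]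
      by (simp add: ennreal_plus distrib_right)
    then have "Ga (affine_param ?a ?b (insert i I) x) + Gb (affine_param ?a ?b (insert i I) x) =
        G2 (affine_param ?a ?b (insert i I) x)" for x
      using dec[of x] by force
    then show ?thesis unfolding N_def by (subst nn_integral_add[symmetric]) simp_all
  qed
  ultimately have main: "N (G1 (real (card (insert i I)))) \<le> N G2"
    by (metis add_mono)
  \<comment> \<open>The way back to the original directions multiplies both sides by the same
    constant.\<close>
  have shear: "(\<integral>\<^sup>+x. G (affine_param a b (insert i I) x) \<partial>coord_lborel (insert i I)) = ennreal \<bar>1 / ?l (b i)\<bar> * N G"
    if "G \<in> borel_measurable borel" for G
    unfolding N_def by (rule nn_integral_shear[where l = ?l]) (use insert.hyps l that in auto)
  have "(\<integral>\<^sup>+x. G1 (real (card (insert i I))) (affine_param a b (insert i I) x) \<partial>coord_lborel (insert i I)) \<le>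
      (\<integral>\<^sup>+x. G2 (affine_param a b (insert i I) x) \<partial>coord_lborel (insert i I))"
    unfolding shear[of "G1 (real (card (insert i I)))", simplified] shear[of G2, simplified]
    by (rule mult_left_mono[OF main]) simp
  then show ?case unfolding G1_def G2_def .
qed

section \<open>Moments of the unit ball\<close>

definition orthonormal_family :: "(nat \<Rightarrow> 'f::real_inner) \<Rightarrow> nat set \<Rightarrow> bool" where
  "orthonormal_family e I \<longleftrightarrow> (\<forall>i\<in>I. \<forall>j\<in>I. inner (e i) (e j) = (if i = j then 1 else 0))"

lemma inner_affine_param_orthonormal:
  assumes "finite I" "orthonormal_family e I" "i \<in> I"
  shows "inner (affine_param 0 e I x) (e i) = x i"
proof -
  have "inner (affine_param 0 e I x) (e i) = (\<Sum>j\<in>I. x j * inner (e j) (e i))"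
    by (simp add: affine_param_def inner_sum_left)
  also have "\<dots> = (\<Sum>j\<in>I. if j = i then x j else 0)"
    by (rule sum.cong) (use assms in \<open>auto simp: orthonormal_family_def\<close>)
  also have "\<dots> = x i" using assms by simp
  finally show ?thesis .
qed

lemma norm_affine_param_orthonormal:
  assumes "finite I" "orthonormal_family e I"
  shows "(norm (affine_param 0 e I x))\<^sup>2 = (\<Sum>i\<in>I. (x i)\<^sup>2)"
proof -
  let ?f = "affine_param 0 e I x"
  have "(norm ?f)\<^sup>2 = inner ?f (\<Sum>i\<in>I. x i *\<^sub>R e i)"
    by (simp add: power2_norm_eq_inner) (simp add: affine_param_def)
  also have "\<dots> = (\<Sum>i\<in>I. x i * inner ?f (e i))"
    by (simp add: inner_sum_right)
  also have "\<dots> = (\<Sum>i\<in>I. (x i)\<^sup>2)"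
    by (rule sum.cong) (simp_all add: inner_affine_param_orthonormal[OF assms] power2_eq_square)
  finally show ?thesis .
qed

lemma orthonormal_imp_indep:
  assumes "finite I" "orthonormal_family e I"
  shows "indep_family e I"
  unfolding indep_family_def
proof (intro allI impI ballI)
  fix c i assume "(\<Sum>i\<in>I. c i *\<^sub>R e i) = 0" "i \<in> I"
  then show "c i = 0" using inner_affine_param_orthonormal[OF assms, of i c]
    by (simp add: affine_param_def)
qed

abbreviation unit_ball :: "'f::real_normed_vector set" where
  "unit_ball \<equiv> {f. (norm f)\<^sup>2 < 1}"

text \<open>Cutting off at 0 makes the weight continuous on the whole space, hence Borel
  there.\<close>

definition ball_weight :: "'f::real_normed_vector \<Rightarrow> real" where
  "ball_weight f = max 0 (1 - (norm f)\<^sup>2)"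

lemma unit_ball_measurable [measurable]: "unit_ball \<in> sets borel"
  by (intro borel_open open_Collect_less continuous_intros)

lemma continuous_ball_weight [continuous_intros]: "continuous_on UNIV ball_weight"
  unfolding ball_weight_def by (intro continuous_intros)

lemma borel_measurable_ennreal_continuous:
  "continuous_on UNIV F \<Longrightarrow> (\<lambda>f. ennreal (F f)) \<in> borel_measurable borel"
  by (rule measurable_compose[OF borel_measurable_continuous_onI measurable_ennreal])

lemma ball_weight_bounds: "0 \<le> ball_weight f" "f \<in> unit_ball \<Longrightarrow> ball_weight f = 1 - (norm f)\<^sup>2"
  "f \<notin> unit_ball \<Longrightarrow> ball_weight f = 0"
  by (auto simp: ball_weight_def)

text \<open>On each line in direction \<open>e i\<close> this is the weighted line identity with
  \<open>s = 1 - (norm g)^2\<close>, where \<open>g\<close> is the component orthogonal to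
  \<open>e i\<close>.\<close>

lemma coordinate_moment:
  fixes e :: "nat \<Rightarrow> 'f::real_inner"
  assumes I: "finite I" "orthonormal_family e I" "i \<in> I" and p: "p = 1 \<or> p = 2"
  shows "(\<integral>\<^sup>+x. ennreal ((x i)\<^sup>2 * ball_weight (affine_param 0 e I x) ^ (p - 1)) *
      indicator unit_ball (affine_param 0 e I x) \<partial>coord_lborel I) =
    (\<integral>\<^sup>+x. ennreal (1 / (2 * real p) * ball_weight (affine_param 0 e I x) ^ p) \<partial>coord_lborel I)"
proof -
  define J where "J = I - {i}"
  have J: "finite J" "i \<notin> J" "I = insert i J" using I by (auto simp: J_def)
  have ei: "norm (e i) = 1" using I by (simp add: orthonormal_family_def norm_eq_1)
  define g where "g = affine_param 0 e J"
  have g: "inner (g x) (e i) = 0" for x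
    unfolding g_def affine_param_def inner_add_left inner_sum_left
    using I J by (auto simp: orthonormal_family_def intro!: sum.neutral)
  have slice: "affine_param (0 + t *\<^sub>R e i) e J x = g x + t *\<^sub>R e i" for x t
    by (simp only: affine_param_add g_def)
  have coord: "inner (g x + t *\<^sub>R e i) (e i) = t" for x t
    using g[of x] ei by (simp add: inner_add_left power2_norm_eq_inner[symmetric])
  note split = norm_orthogonal_line(2)[OF g ei]
  define G where "G = (\<lambda>f. ennreal ((inner f (e i))\<^sup>2 * ball_weight f ^ (p - 1)) * indicator unit_ball f)"
  define G' where "G' = (\<lambda>f::'f. ennreal (1 / (2 * real p) * ball_weight f ^ p))"
  have [measurable]: "G \<in> borel_measurable borel"
    unfolding G_def by (intro borel_measurable_times_ennreal borel_measurable_indicator unit_ball_measurable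
        borel_measurable_ennreal_continuous continuous_intros)
  have [measurable]: "G' \<in> borel_measurable borel"
    unfolding G'_def by (intro borel_measurable_ennreal_continuous continuous_intros)
  have "(\<integral>\<^sup>+x. G (affine_param 0 e I x) \<partial>coord_lborel I) = (\<integral>\<^sup>+x. G' (affine_param 0 e I x) \<partial>coord_lborel I)"
    unfolding J(3)
  proof (subst (1 2) nn_integral_slices(2)[OF J(1,2)], unfold slice)
    show "(\<integral>\<^sup>+x. \<integral>\<^sup>+t. G (g x + t *\<^sub>R e i) \<partial>lborel \<partial>coord_lborel J) =
      (\<integral>\<^sup>+x. \<integral>\<^sup>+t. G' (g x + t *\<^sub>R e i) \<partial>lborel \<partial>coord_lborel J)"
    proof (rule nn_integral_cong)
      fix x
      define s where "s = 1 - (norm (g x))\<^sup>2"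
      have w: "ball_weight (g x + t *\<^sub>R e i) = max 0 (s - t\<^sup>2)" for t
        unfolding ball_weight_def split s_def by (simp add: algebra_simps)
      have ind: "indicator unit_ball (g x + t *\<^sub>R e i) = (indicator {t. t\<^sup>2 < s} t :: ennreal)" for t
        by (auto simp: indicator_def split s_def)
      show "(\<integral>\<^sup>+t. G (g x + t *\<^sub>R e i) \<partial>lborel) = (\<integral>\<^sup>+t. G' (g x + t *\<^sub>R e i) \<partial>lborel)"
        unfolding G_def G'_def coord w ind by (rule line_weighted_second_moment[OF p])
    qed
  qed measurable
  then show ?thesis unfolding G_def G'_def inner_affine_param_orthonormal[OF I] .
qed

text \<open>These moments are not normalised: the case \<open>p = 0\<close> is the volume of the
  ball, and only there does the indicator make a difference.\<close>

definition ball_moment :: "(nat \<Rightarrow> 'f::real_normed_vector) \<Rightarrow> nat set \<Rightarrow> nat \<Rightarrow> ennreal" where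
  "ball_moment e I p = (\<integral>\<^sup>+x. ennreal (ball_weight (affine_param 0 e I x) ^ p) *
    indicator unit_ball (affine_param 0 e I x) \<partial>coord_lborel I)"

text \<open>On the ball \<open>1 = q + (norm f)^2\<close> with \<open>q = ball_weight f\<close>.
  Multiplying by \<open>q ^ (p - 1)\<close> and summing the coordinate moments turns the last term
  into \<open>card I / (2 * p)\<close> times the next moment.\<close>

lemma ball_moment_recursion:
  fixes e :: "nat \<Rightarrow> 'f::real_inner"
  assumes I: "finite I" "orthonormal_family e I" and p: "p = 1 \<or> p = 2"
  shows "ball_moment e I (p - 1) = ennreal (1 + real (card I) / (2 * real p)) * ball_moment e I p"
proof -
  let ?f = "affine_param 0 e I" and ?c = "real (card I) / (2 * real p)"
  note [measurable] = affine_param_measurable[OF I(1)]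
  have [measurable]: "(\<lambda>f::'f. ennreal (ball_weight f ^ p)) \<in> borel_measurable borel"
      "(\<lambda>f::'f. ennreal (1 / (2 * real p) * ball_weight f ^ p)) \<in> borel_measurable borel"
      "(\<lambda>f::'f. ennreal ((inner f (e i))\<^sup>2 * ball_weight f ^ (p - 1)) * indicator unit_ball f) \<in> borel_measurable borel"
      "(\<lambda>f::'f. ennreal ((norm f)\<^sup>2 * ball_weight f ^ (p - 1)) * indicator unit_ball f) \<in> borel_measurable borel" for p i
    by (intro borel_measurable_ennreal_continuous borel_measurable_times_ennreal borel_measurable_indicator
        unit_ball_measurable continuous_intros)+
  have ind: "ennreal (ball_weight f ^ p) * indicator unit_ball f = ennreal (ball_weight f ^ p)" for f :: 'f
    using p by (cases "f \<in> unit_ball") (auto simp: ball_weight_bounds zero_power)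
  have coord [measurable]: "(\<lambda>x. ennreal ((x i)\<^sup>2 * ball_weight (?f x) ^ (p - 1)) * indicator unit_ball (?f x))
      \<in> borel_measurable (coord_lborel I)" if "i \<in> I" for i
  proof -
    have "(\<lambda>x. ennreal ((inner (?f x) (e i))\<^sup>2 * ball_weight (?f x) ^ (p - 1)) * indicator unit_ball (?f x))
      \<in> borel_measurable (coord_lborel I)" by measurable
    then show ?thesis unfolding inner_affine_param_orthonormal[OF I that] .
  qed
  have "(\<integral>\<^sup>+x. ennreal ((norm (?f x))\<^sup>2 * ball_weight (?f x) ^ (p - 1)) * indicator unit_ball (?f x) \<partial>coord_lborel I) =
      (\<integral>\<^sup>+x. (\<Sum>i\<in>I. ennreal ((x i)\<^sup>2 * ball_weight (?f x) ^ (p - 1)) * indicator unit_ball (?f x)) \<partial>coord_lborel I)"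
    unfolding norm_affine_param_orthonormal[OF I] sum_distrib_right
    by (simp add: sum_ennreal ball_weight_bounds flip: sum_distrib_right)
  also have "\<dots> = (\<Sum>i\<in>I. (\<integral>\<^sup>+x. ennreal ((x i)\<^sup>2 * ball_weight (?f x) ^ (p - 1)) * indicator unit_ball (?f x) \<partial>coord_lborel I))"
    by (rule nn_integral_sum) (rule coord)
  also have "\<dots> = (\<Sum>i\<in>I. (\<integral>\<^sup>+x. ennreal (1 / (2 * real p) * ball_weight (?f x) ^ p) \<partial>coord_lborel I))"
    by (rule sum.cong[OF refl]) (rule coordinate_moment[OF I _ p])
  also have "\<dots> = ennreal (real (card I)) * (\<integral>\<^sup>+x. ennreal (1 / (2 * real p) * ball_weight (?f x) ^ p) \<partial>coord_lborel I)"
    by (simp add: ennreal_of_nat_eq_real_of_nat)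
  also have "\<dots> = (\<integral>\<^sup>+x. ennreal (real (card I)) * ennreal (1 / (2 * real p) * ball_weight (?f x) ^ p) \<partial>coord_lborel I)"
    by (rule nn_integral_cmult[symmetric]) measurable
  also have "\<dots> = (\<integral>\<^sup>+x. ennreal ?c * ennreal (ball_weight (?f x) ^ p) \<partial>coord_lborel I)"
    by (simp add: ennreal_mult[symmetric] ball_weight_bounds)
  also have "\<dots> = ennreal ?c * ball_moment e I p"
    unfolding ball_moment_def ind by (rule nn_integral_cmult) measurable
  finally have *: "(\<integral>\<^sup>+x. ennreal ((norm (?f x))\<^sup>2 * ball_weight (?f x) ^ (p - 1)) * indicator unit_ball (?f x) \<partial>coord_lborel I) = \<dots>" .
  have "ennreal (ball_weight f ^ (p - 1)) * indicator unit_ball f = ennreal (ball_weight f ^ p) +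
      ennreal ((norm f)\<^sup>2 * ball_weight f ^ (p - 1)) * indicator unit_ball f" for f :: 'f
  proof (cases "f \<in> unit_ball")
    case True
    have "ball_weight f ^ (p - 1) = ball_weight f ^ p + (norm f)\<^sup>2 * ball_weight f ^ (p - 1)"
      using p by (auto simp: ball_weight_bounds(2)[OF True] power2_eq_square algebra_simps)
    then show ?thesis using True by (simp add: ennreal_plus[symmetric] ball_weight_bounds(1) del: ennreal_plus)
  next
    case False
    then show ?thesis using p by (auto simp: ball_weight_bounds zero_power)
  qed
  then have "ball_moment e I (p - 1) = (\<integral>\<^sup>+x. ennreal (ball_weight (?f x) ^ p) +
      ennreal ((norm (?f x))\<^sup>2 * ball_weight (?f x) ^ (p - 1)) * indicator unit_ball (?f x) \<partial>coord_lborel I)"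
    unfolding ball_moment_def by (simp only:)
  also have "\<dots> = ball_moment e I p + ennreal ?c * ball_moment e I p"
    unfolding *[symmetric] unfolding ball_moment_def ind by (rule nn_integral_add) measurable
  also have "\<dots> = ennreal (1 + ?c) * ball_moment e I p"
    by (simp add: ennreal_plus distrib_right)
  finally show ?thesis .
qed

text \<open>The ball contains a small cube and lies in the cube of half-width 1. Both bounds are
  needed in order to cancel a moment later.\<close>

lemma ball_moment_zero_bounds:
  fixes e :: "nat \<Rightarrow> 'f::real_inner"
  assumes I: "finite I" "orthonormal_family e I"
  shows "ball_moment e I 0 \<noteq> 0" "ball_moment e I 0 < \<top>"
proof -
  let ?f = "affine_param 0 e I"
  have box: "(\<integral>\<^sup>+x. indicator (Pi\<^sub>E I (\<lambda>_. {-r..r})) x \<partial>coord_lborel I) = ennreal ((2 * r) ^ card I)"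
    if "r \<ge> 0" for r :: real
  proof -
    have "(\<integral>\<^sup>+x. indicator (Pi\<^sub>E I (\<lambda>_. {-r..r})) x \<partial>coord_lborel I) = emeasure (coord_lborel I) (Pi\<^sub>E I (\<lambda>_. {-r..r}))"
      by (rule nn_integral_indicator) (intro sets_PiM_I_finite I, simp)
    also have "\<dots> = (\<Prod>i\<in>I. emeasure lborel {-r..r})"
      by (rule lborel_prod.emeasure_PiM[OF I(1)]) simp
    finally show ?thesis using that by (simp add: ennreal_power)
  qed
  have "ball_moment e I 0 \<le> (\<integral>\<^sup>+x. indicator (Pi\<^sub>E I (\<lambda>_. {-1..1})) x \<partial>coord_lborel I)"
    unfolding ball_moment_def
  proof (rule nn_integral_mono)
    fix x assume x: "x \<in> space (coord_lborel I)"
    have "x i \<in> {-1..1}" if "i \<in> I" "?f x \<in> unit_ball" for i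
    proof -
      have "(x i)\<^sup>2 \<le> (\<Sum>i\<in>I. (x i)\<^sup>2)" by (rule member_le_sum) (use I that in auto)
      also have "\<dots> \<le> 1" using that norm_affine_param_orthonormal[OF I, of x] by simp
      finally show ?thesis by (auto simp: abs_square_le_1 abs_le_iff)
    qed
    then show "ennreal (ball_weight (?f x) ^ 0) * indicator unit_ball (?f x) \<le> indicator (Pi\<^sub>E I (\<lambda>_. {-1..1})) x"
      using x by (auto simp: indicator_def space_PiM PiE_iff)
  qed
  also have "\<dots> < \<top>" unfolding box[OF zero_le_one] by (rule ennreal_less_top)
  finally show "ball_moment e I 0 < \<top>" .
  \<comment> \<open>Since \<open>r \<le> 1\<close>, the squared norm on the small cube is at most
    \<open>card I * r\<close>, which is below 1.\<close>
  define r where "r = 1 / (real (card I) + 1)"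
  have r: "0 < r" "r \<le> 1" "real (card I) * r < 1" by (auto simp: r_def field_simps)
  have "0 < ennreal ((2 * r) ^ card I)" using r by (simp add: ennreal_less_zero_iff)
  also have "\<dots> = (\<integral>\<^sup>+x. indicator (Pi\<^sub>E I (\<lambda>_. {-r..r})) x \<partial>coord_lborel I)" using box[of r] r by simp
  also have "\<dots> \<le> ball_moment e I 0"
    unfolding ball_moment_def
  proof (rule nn_integral_mono)
    fix x :: "nat \<Rightarrow> real"
    have "?f x \<in> unit_ball" if "x \<in> Pi\<^sub>E I (\<lambda>_. {-r..r})"
    proof -
      have "(\<Sum>i\<in>I. (x i)\<^sup>2) \<le> (\<Sum>i\<in>I. r)"
      proof (rule sum_mono)
        fix i assume "i \<in> I"
        then have "\<bar>x i\<bar> \<le> r" using that by (fastforce simp: PiE_iff abs_le_iff)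
        then have "\<bar>x i\<bar> * \<bar>x i\<bar> \<le> r * 1" by (intro mult_mono) (use r in auto)
        then show "(x i)\<^sup>2 \<le> r" by (simp add: power2_eq_square)
      qed
      then show ?thesis using r norm_affine_param_orthonormal[OF I, of x] by simp
    qed
    then show "indicator (Pi\<^sub>E I (\<lambda>_. {-r..r})) x \<le> ennreal (ball_weight (?f x) ^ 0) * indicator unit_ball (?f x)"
      by (auto simp: indicator_def)
  qed
  finally show "ball_moment e I 0 \<noteq> 0" by simp
qed

section \<open>Adaptive algorithms under the uniform prior\<close>

text \<open>The slice is the set of inputs reached by a common history \<open>h\<close> of
  \<open>j\<close> observations, none of which led to a stop. Each observation lowers the dimension
  by at most one, whence \<open>m \<le> real (j + card I)\<close>. Outputs are points of the source
  space here, the original outputs having been pulled back.\<close>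

lemma adaptive_bayes_bound:
  fixes L :: "real list \<Rightarrow> 'f::real_inner \<Rightarrow> real" and out :: "real list \<Rightarrow> 'f"
    and tau :: "'f \<Rightarrow> nat" and m c lam :: real
  defines "cost \<equiv> \<lambda>f. ennreal ((norm (f - out (info L f (tau f))))\<^sup>2 + lam * real (tau f) + c * (ball_weight f)\<^sup>2)"
  assumes lin: "\<And>ys. linear (L ys)"
    and tau: "\<And>f. stop (info L f (tau f))" "\<And>f i. i < tau f \<Longrightarrow> \<not> stop (info L f i)"
    and meas [measurable]: "cost \<in> borel_measurable borel"
    and pos: "0 < c" "0 < lam" "0 < m" and param: "m \<le> 16 * c * lam"
    and "finite I" "indep_family b I" and "m \<le> real (j + card I)"
    and "\<And>x. info L (affine_param a b I x) j = h"
    and "\<And>x i. i < j \<Longrightarrow> \<not> stop (info L (affine_param a b I x) i)"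
  shows "(\<integral>\<^sup>+x. ennreal (m / 2 * ball_weight (affine_param a b I x)) \<partial>coord_lborel I) \<le>
    (\<integral>\<^sup>+x. cost (affine_param a b I x) * indicator unit_ball (affine_param a b I x) \<partial>coord_lborel I)"
proof -
  define G1 where "G1 = (\<lambda>f::'f. ennreal (m / 2 * ball_weight f))"
  define G2 where "G2 = (\<lambda>f. cost f * indicator unit_ball f)"
  have [measurable]: "G1 \<in> borel_measurable borel"
    unfolding G1_def by (intro borel_measurable_ennreal_continuous continuous_intros)
  have [measurable]: "G2 \<in> borel_measurable borel"
    unfolding G2_def by measurable
  \<comment> \<open>The number of observations may be unbounded over the inputs. After
    \<open>N\<close> of them their price alone reaches \<open>m / 2\<close>, so the induction can
    end there.\<close>
  define N where "N = nat \<lceil>m / (2 * lam)\<rceil>"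
  have N: "m / 2 \<le> lam * real N"
  proof -
    have "m / (2 * lam) \<le> real N" unfolding N_def by linarith
    then show ?thesis using pos by (simp add: field_simps)
  qed
  have "(\<integral>\<^sup>+x. G1 (affine_param a b I x) \<partial>coord_lborel I) \<le> (\<integral>\<^sup>+x. G2 (affine_param a b I x) \<partial>coord_lborel I)"
    \<comment> \<open>These are exactly the hypotheses on the current slice and history, which
      change from one observation to the next.\<close>
    using assms(10-)
  proof (induction "N - j" arbitrary: j h I a b rule: less_induct)
    case less
    note I = less.prems(1) and indep = less.prems(2) and dim = less.prems(3)
      and hist = less.prems(4) and nonstop = less.prems(5)
    note [measurable] = affine_param_measurable[OF I]
    let ?f = "affine_param a b I"
    have tau_ge: "j \<le> tau (?f x)" for x
      using tau(1)[of "?f x"] nonstop[of "tau (?f x)" x] by (meson not_le)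
    consider "N \<le> j" | "stop h" | "j < N" "\<not> stop h" by linarith
    then show ?case
    proof cases
      case 1
      show ?thesis
      proof (rule nn_integral_mono)
        fix x
        have "m / 2 * ball_weight (?f x) \<le> m / 2 * 1"
          using pos by (intro mult_left_mono) (auto simp: ball_weight_def)
        also have "\<dots> \<le> lam * real (tau (?f x))"
        proof -
          have "lam * real N \<le> lam * real (tau (?f x))"
            using pos 1 tau_ge[of x] by (intro mult_left_mono) auto
          then show ?thesis using N by simp
        qed
        also have "\<dots> \<le> (norm (?f x - out (info L (?f x) (tau (?f x)))))\<^sup>2 + lam * real (tau (?f x)) + c * (ball_weight (?f x))\<^sup>2"
          using pos by simp
        finally show "G1 (?f x) \<le> G2 (?f x)"
          by (cases "?f x \<in> unit_ball") (auto simp: G1_def G2_def cost_def ball_weight_bounds(3) intro!: ennreal_leI)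
      qed
    next
      \<comment> \<open>The whole slice stops now with the same history, so the output is one
        constant \<open>A\<close> and the second moment bound for slices applies.\<close>
      case 2
      define k where "k = real (card I)"
      define A where "A = out h"
      have "tau (?f x) = j" for x
        using 2 hist[of x] tau_ge[of x] tau(2)[of j "?f x"] by (metis le_neq_implies_less)
      then have cost: "cost (?f x) = ennreal ((norm (?f x - A))\<^sup>2 + lam * real j + c * (ball_weight (?f x))\<^sup>2)" for x
        unfolding cost_def A_def by (simp add: hist)
      define D where "D = (\<lambda>f::'f. ennreal ((norm (f - A))\<^sup>2) * indicator unit_ball f)"
      define E where "E = (\<lambda>f::'f. ennreal (lam * real j + c * (ball_weight f)\<^sup>2) * indicator unit_ball f)"
      define K where "K = (\<lambda>f::'f. ennreal (k / 2 * ball_weight f))"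
      have [measurable]: "D \<in> borel_measurable borel" "E \<in> borel_measurable borel" "K \<in> borel_measurable borel"
        unfolding D_def E_def K_def by (intro borel_measurable_ennreal_continuous borel_measurable_times_ennreal
            borel_measurable_indicator unit_ball_measurable continuous_intros)+
      have G2: "G2 (?f x) = D (?f x) + E (?f x)" for x
        using pos unfolding G2_def cost D_def E_def
        by (subst distrib_right[symmetric], subst ennreal_plus[symmetric]) (auto simp: add.assoc)
      \<comment> \<open>Second moments pay for \<open>k\<close> of the \<open>m\<close> dimensions;
        \<open>E\<close> has to pay for the rest, pointwise.\<close>
      have G1: "G1 f \<le> K f + E f" for f
      proof (cases "f \<in> unit_ball")
        case True
        define q where "q = ball_weight f"
        have q: "0 \<le> q" by (simp add: q_def ball_weight_bounds)
        have "m / 2 * q \<le> k / 2 * q + (lam * real j + c * q\<^sup>2)"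
        proof (cases "m \<le> k")
          case True
          then have "m / 2 * q \<le> k / 2 * q" using q by (intro mult_right_mono) auto
          moreover have "0 \<le> lam * real j + c * q\<^sup>2" using pos by simp
          ultimately show ?thesis by linarith
        next
          case False
          \<comment> \<open>The deficit \<open>d\<close> is at most both \<open>m\<close> and
            \<open>j\<close>. Expanding \<open>(4 * c * q - d)^2 \<ge> 0\<close> and using
            \<open>d \<le> m \<le> 16 * c * lam\<close> bounds \<open>d * q\<close> by twice
            \<open>c * q^2 + lam * d\<close>.\<close>
          define d where "d = m - k"
          have d: "0 < d" "d \<le> m" "d \<le> real j" using False dim by (auto simp: d_def k_def)
          have "d * d \<le> d * (16 * c * lam)" using d param by (intro mult_left_mono) auto
          moreover have "0 \<le> (4 * c * q - d)\<^sup>2" by simp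
          ultimately have "8 * c * (d * q) \<le> 8 * c * (2 * (c * q\<^sup>2 + lam * d))"
            by (simp add: power2_eq_square algebra_simps)
          then have "d * q \<le> 2 * (c * q\<^sup>2 + lam * d)"
            by (rule mult_left_le_imp_le) (use pos in simp)
          moreover have "lam * d \<le> lam * real j" using d pos by simp
          ultimately show ?thesis by (simp add: d_def algebra_simps)
        qed
        then have "G1 f \<le> ennreal (k / 2 * q + (lam * real j + c * q\<^sup>2))"
          unfolding G1_def q_def by (rule ennreal_leI)
        also have "\<dots> = K f + E f"
          using True q pos unfolding K_def E_def q_def k_def by (subst ennreal_plus) auto
        finally show ?thesis .
      next
        case False
        then show ?thesis by (simp add: G1_def ball_weight_bounds)
      qed
      have "(\<integral>\<^sup>+x. G1 (?f x) \<partial>coord_lborel I) \<le> (\<integral>\<^sup>+x. K (?f x) + E (?f x) \<partial>coord_lborel I)"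
        by (rule nn_integral_mono) (rule G1)
      also have "\<dots> = (\<integral>\<^sup>+x. K (?f x) \<partial>coord_lborel I) + (\<integral>\<^sup>+x. E (?f x) \<partial>coord_lborel I)"
        by (rule nn_integral_add) measurable
      also have "\<dots> \<le> (\<integral>\<^sup>+x. D (?f x) \<partial>coord_lborel I) + (\<integral>\<^sup>+x. E (?f x) \<partial>coord_lborel I)"
        unfolding K_def D_def k_def ball_weight_def
        by (rule add_right_mono) (rule slice_second_moment[OF I indep])
      also have "\<dots> = (\<integral>\<^sup>+x. D (?f x) + E (?f x) \<partial>coord_lborel I)"
        by (rule nn_integral_add[symmetric]) measurable
      also have "\<dots> = (\<integral>\<^sup>+x. G2 (?f x) \<partial>coord_lborel I)"
        by (simp only: G2)
      finally show ?thesis .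
    next
      case 3
      let ?l = "L h"
      have l: "linear ?l" by (rule lin)
      have dec: "N - Suc j < N - j" using 3 by simp
      show ?thesis
      proof (cases "\<forall>i\<in>I. ?l (b i) = 0")
        \<comment> \<open>The functional is constant on the slice, so the observation is paid for
          without any loss of dimension.\<close>
        case True
        have "?l (?f x) = ?l a" for x using True by (simp add: linear_affine_param[OF l])
        then have hist': "info L (?f x) (Suc j) = h @ [?l a]" for x using hist[of x] by simp
        show ?thesis
        proof (rule less.hyps[OF dec I indep _ hist'])
          show "m \<le> real (Suc j + card I)" using dim by simp
          show "\<not> stop (info L (?f x) i)" if "i < Suc j" for x i
            using that nonstop[of i x] hist[of x] 3 by (auto simp: less_Suc_eq)
        qed
      next
        case False
        then obtain i where i: "i \<in> I" "?l (b i) \<noteq> 0" by blast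
        define J where "J = I - {i}"
        have J: "finite J" "i \<notin> J" "I = insert i J" using I i by (auto simp: J_def)
        let ?a = "shear_base ?l i b a" and ?b = "shear_dirs ?l i b"
        have indep': "indep_family ?b J"
          by (rule indep_shear) (use indep J in auto)
        have shear: "(\<integral>\<^sup>+x. G (?f x) \<partial>coord_lborel I) = ennreal \<bar>1 / ?l (b i)\<bar> *
            (\<integral>\<^sup>+t. (\<integral>\<^sup>+x. G (affine_param (?a + t *\<^sub>R ?b i) ?b J x) \<partial>coord_lborel J) \<partial>lborel)"
          if "G \<in> borel_measurable borel" for G
          unfolding J(3)
            nn_integral_shear[where l = ?l and b = b and i = i and a = a, OF J(1,2) l i(2) that]
            nn_integral_slices(1)[OF J(1,2) that] ..
        \<comment> \<open>Each observed value \<open>t\<close> is treated on its own slice. The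
          extended history is constant there, so nothing about its dependence on \<open>t\<close> is
          used.\<close>
        have slice: "(\<integral>\<^sup>+x. G1 (affine_param (?a + t *\<^sub>R ?b i) ?b J x) \<partial>coord_lborel J) \<le>
            (\<integral>\<^sup>+x. G2 (affine_param (?a + t *\<^sub>R ?b i) ?b J x) \<partial>coord_lborel J)" for t
        proof -
          let ?g = "affine_param (?a + t *\<^sub>R ?b i) ?b J"
          \<comment> \<open>The new slice lies in the old one, so its points inherit the history and
            the absence of earlier stops.\<close>
          have ex: "\<exists>y. ?g x = ?f y" for x
          proof -
            have "?g x = affine_param ?a ?b (insert i J) (x(i := t))"
              by (simp only: affine_param_insert_upd[OF J(1,2)])
            also note affine_param_shear[OF J(1,2)]
            finally show ?thesis unfolding J(3) by blast
          qed
          have val: "?l (?g x) = t" for x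
          proof -
            have "?l (?g x) = ?l (?a + t *\<^sub>R ?b i) + (\<Sum>j\<in>J. x j * ?l (?b j))"
              by (rule linear_affine_param[OF l])
            also have "(\<Sum>j\<in>J. x j * ?l (?b j)) = 0"
            proof (intro sum.neutral ballI)
              fix j assume "j \<in> J"
              then have "j \<noteq> i" using J by auto
              then show "x j * ?l (?b j) = 0" using shear_zero(2)[of ?l b i j] l i by simp
            qed
            also have "?l (?a + t *\<^sub>R ?b i) = t"
              using shear_zero(1,3)[of ?l b i, OF l i(2)] by (simp add: linear_add[OF l] linear_cmul[OF l])
            finally show ?thesis by simp
          qed
          have hist': "info L (?g x) j = h" for x using ex[of x] hist by metis
          show ?thesis
          proof (rule less.hyps[OF dec J(1) indep'])
            show "m \<le> real (Suc j + card J)" using dim J by simp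
            show "info L (?g x) (Suc j) = h @ [t]" for x using hist'[of x] val[of x] by simp
            show "\<not> stop (info L (?g x) i')" if "i' < Suc j" for x i'
              using that ex[of x] nonstop[of i'] hist'[of x] 3 by (metis less_Suc_eq)
          qed
        qed
        show ?thesis
          unfolding shear[of G1, simplified] shear[of G2, simplified]
          by (intro mult_left_mono nn_integral_mono slice) simp
      qed
    qed
  qed
  then show ?thesis unfolding G1_def G2_def .
qed

text \<open>This is the averaged inequality divided by the second moment, with
  \<open>m = 4 * n\<close> and \<open>y\<close> standing for the squared error relative to the
  smallest singular value. If \<open>y < 1 / 4\<close>, clearing denominators leaves
  \<open>6 * m^3 + 71 * m^2 < 71 * m + 840\<close>, which fails from \<open>m = 4\<close>
  on.\<close>

lemma prior_arithmetic:
  fixes m y :: real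
  assumes m: "4 \<le> m"
    and ineq: "m / 2 * (1 + m / 4) \<le> (y + 10 / (7 * (m + 3)) * (m / 4)) * ((1 + m / 2) * (1 + m / 4)) + 7 * m * (m + 3) / 160"
  shows "1 / 4 \<le> y"
proof (rule ccontr)
  assume "\<not> 1 / 4 \<le> y"
  define K where "K = (1 + m / 2) * (1 + m / 4)"
  have K: "0 < K" unfolding K_def using m by simp
  have "(y + 10 / (7 * (m + 3)) * (m / 4)) * K < (1 / 4 + 10 / (7 * (m + 3)) * (m / 4)) * K"
    by (rule mult_strict_right_mono) (use \<open>\<not> 1 / 4 \<le> y\<close> K in auto)
  with ineq have "m / 2 * (1 + m / 4) < (1 / 4 + 10 / (7 * (m + 3)) * (m / 4)) * K + 7 * m * (m + 3) / 160"
    unfolding K_def by linarith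
  then have "m / 2 * (1 + m / 4) * (1120 * (m + 3)) <
      ((1 / 4 + 10 / (7 * (m + 3)) * (m / 4)) * K + 7 * m * (m + 3) / 160) * (1120 * (m + 3))"
    by (rule mult_strict_right_mono) (use m in simp)
  also have "\<dots> = (35 * (m + 3) + 50 * m) * (8 * K) + 49 * m * (m + 3) * (m + 3)"
    using m by (simp add: field_simps)
  also have "8 * K = (m + 2) * (m + 4)" unfolding K_def by (simp add: field_simps)
  finally have "140 * m * (m + 4) * (m + 3) < (35 * (m + 3) + 50 * m) * ((m + 2) * (m + 4)) + 49 * m * (m + 3) * (m + 3)"
    by (simp add: field_simps)
  then have "6 * (m * m * m) + 71 * (m * m) < 71 * m + 840" by (simp add: algebra_simps)
  moreover have "4 * 4 \<le> m * m" using m by (intro mult_mono) auto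
  moreover have "16 * 4 \<le> (m * m) * m" by (rule mult_mono) (use m \<open>4 * 4 \<le> m * m\<close> in auto)
  moreover have "4 * m \<le> m * m" using m by (intro mult_right_mono) auto
  ultimately show False using m by linarith
qed

lemma ennreal_sqrt_le_imp:
  assumes "ennreal_sqrt x \<le> ennreal r" "0 \<le> r"
  shows "x \<le> ennreal (r\<^sup>2)"
proof -
  have x: "x \<noteq> \<top>" using assms by (auto simp: ennreal_sqrt_def top_unique split: if_splits)
  then obtain y where y: "x = ennreal y" "0 \<le> y" by (cases x) auto
  then have "sqrt y \<le> r" using assms by (simp add: ennreal_sqrt_def)
  then have "y \<le> r\<^sup>2" using y by (metis real_sqrt_le_iff real_sqrt_unique assms(2) abs_of_nonneg real_sqrt_abs)
  then show ?thesis using y by (simp add: ennreal_leI)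
qed

section \<open>Pulling outputs back to the source space\<close>

definition pseudo_inverse :: "('f::real_inner \<Rightarrow> 'g::real_inner) \<Rightarrow> (nat \<Rightarrow> 'f) \<Rightarrow> nat set \<Rightarrow> 'g \<Rightarrow> 'f" where
  "pseudo_inverse S e I g = affine_param 0 e I (\<lambda>i. inner g (S (e i)) / (norm (S (e i)))\<^sup>2)"

text \<open>\<open>pseudo_inverse\<close> projects \<open>g\<close> onto the span of the orthogonal
  vectors \<open>S (e i)\<close> and inverts \<open>S\<close> there. The residual of the projection
  is orthogonal to that span and only adds to the error, while \<open>S\<close> stretches the
  remaining difference by at least \<open>s\<close>.\<close>

lemma pseudo_inverse_error:
  assumes S: "linear S" and I: "finite I" "orthonormal_family e I"
    and orth: "\<And>i j. i \<in> I \<Longrightarrow> j \<in> I \<Longrightarrow> i \<noteq> j \<Longrightarrow> inner (S (e i)) (S (e j)) = 0"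
    and s: "0 < s" "\<And>i. i \<in> I \<Longrightarrow> s \<le> norm (S (e i))"
  shows "s\<^sup>2 * (norm (affine_param 0 e I x - pseudo_inverse S e I g))\<^sup>2 \<le> (norm (S (affine_param 0 e I x) - g))\<^sup>2"
proof -
  define t where "t = (\<lambda>i. inner g (S (e i)) / (norm (S (e i)))\<^sup>2)"
  define d where "d = (\<lambda>i. x i - t i)"
  have S_param: "S (affine_param 0 e I z) = (\<Sum>i\<in>I. z i *\<^sub>R S (e i))" for z
    using S by (simp add: affine_param_def linear_sum linear_cmul)
  have inner_S: "inner (S (affine_param 0 e I z)) (S (e i)) = z i * (norm (S (e i)))\<^sup>2" if "i \<in> I" for z i
  proof -
    have "inner (S (affine_param 0 e I z)) (S (e i)) = (\<Sum>j\<in>I. z j * inner (S (e j)) (S (e i)))"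
      by (simp add: S_param inner_sum_left)
    also have "\<dots> = (\<Sum>j\<in>I. if j = i then z i * (norm (S (e i)))\<^sup>2 else 0)"
      by (rule sum.cong) (use orth that in \<open>auto simp: power2_norm_eq_inner\<close>)
    also have "\<dots> = z i * (norm (S (e i)))\<^sup>2" using I that by simp
    finally show ?thesis .
  qed
  define r where "r = S (affine_param 0 e I d)"
  define q where "q = S (affine_param 0 e I t) - g"
  have diff: "affine_param 0 e I x - affine_param 0 e I t = affine_param 0 e I d"
    by (simp add: affine_param_def d_def sum_subtractf scaleR_diff_left)
  then have Sx: "S (affine_param 0 e I x) - g = r + q"
    unfolding r_def q_def diff[symmetric] linear_diff[OF S] by simp
  have "inner q (S (e i)) = 0" if "i \<in> I" for i
    using s(1) s(2)[OF that] inner_S[OF that, of t] by (simp add: q_def inner_diff_left t_def)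
  then have "inner q r = 0" unfolding r_def S_param inner_sum_right by (intro sum.neutral) simp
  then have "(norm (r + q))\<^sup>2 = (norm r)\<^sup>2 + (norm q)\<^sup>2"
    by (simp add: power2_norm_eq_inner inner_add_left inner_add_right inner_commute[of r q])
  moreover have "(norm r)\<^sup>2 = (\<Sum>i\<in>I. (d i)\<^sup>2 * (norm (S (e i)))\<^sup>2)"
  proof -
    have "(norm r)\<^sup>2 = (\<Sum>i\<in>I. d i * inner r (S (e i)))"
      by (simp add: power2_norm_eq_inner) (subst (2) r_def, simp add: S_param inner_sum_right)
    also have "\<dots> = (\<Sum>i\<in>I. (d i)\<^sup>2 * (norm (S (e i)))\<^sup>2)"
      by (rule sum.cong) (simp_all add: r_def inner_S power2_eq_square)
    finally show ?thesis .
  qed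
  moreover have "s\<^sup>2 * (\<Sum>i\<in>I. (d i)\<^sup>2) \<le> (\<Sum>i\<in>I. (d i)\<^sup>2 * (norm (S (e i)))\<^sup>2)"
    unfolding sum_distrib_left
  proof (rule sum_mono)
    fix i assume "i \<in> I"
    then have "s\<^sup>2 \<le> (norm (S (e i)))\<^sup>2" using s by (intro power_mono) auto
    then show "s\<^sup>2 * (d i)\<^sup>2 \<le> (d i)\<^sup>2 * (norm (S (e i)))\<^sup>2"
      by (subst mult.commute) (rule mult_left_mono, auto)
  qed
  ultimately have "s\<^sup>2 * (\<Sum>i\<in>I. (d i)\<^sup>2) \<le> (norm (S (affine_param 0 e I x) - g))\<^sup>2"
    unfolding Sx by (smt (verit) zero_le_power2)
  then show ?thesis
    unfolding pseudo_inverse_def t_def[symmetric] diff norm_affine_param_orthonormal[OF I] .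
qed

text \<open>Serves measurability: the error becomes an expression in real-valued continuous
  functions of \<open>f\<close> and of \<open>g\<close>, so no measurable subtraction in a possibly
  nonseparable space is required.\<close>

lemma norm_diff_pseudo_inverse:
  assumes "finite I" "orthonormal_family e I"
  shows "(norm (f - pseudo_inverse S e I g))\<^sup>2 = (norm f)\<^sup>2
    - 2 * (\<Sum>i\<in>I. inner g (S (e i)) / (norm (S (e i)))\<^sup>2 * inner f (e i))
    + (\<Sum>i\<in>I. (inner g (S (e i)) / (norm (S (e i)))\<^sup>2)\<^sup>2)"
proof -
  let ?t = "\<lambda>i. inner g (S (e i)) / (norm (S (e i)))\<^sup>2"
  have "(norm (f - affine_param 0 e I ?t))\<^sup>2 = (norm f)\<^sup>2 - 2 * inner f (affine_param 0 e I ?t) + (norm (affine_param 0 e I ?t))\<^sup>2"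
    by (simp add: power2_norm_eq_inner inner_diff_left inner_diff_right inner_commute)
  moreover have "inner f (affine_param 0 e I ?t) = (\<Sum>i\<in>I. ?t i * inner f (e i))"
    by (simp add: affine_param_def inner_sum_right)
  ultimately show ?thesis unfolding pseudo_inverse_def norm_affine_param_orthonormal[OF assms] by simp
qed

section \<open>Averaging a randomized algorithm over the ball\<close>

lemma randomized_lower_bound:
  fixes S :: "'f::real_inner \<Rightarrow> 'g::real_inner" and A :: "('w, 'f, 'g) randomized_algorithm"
  assumes S: "linear S" and n: "n \<ge> 1"
    and e: "orthonormal_family e {..<4 * n}"
    and orth: "\<And>i j. i < 4 * n \<Longrightarrow> j < 4 * n \<Longrightarrow> i \<noteq> j \<Longrightarrow> inner (S (e i)) (S (e j)) = 0"
    and s: "0 < s" "\<And>i. i < 4 * n \<Longrightarrow> s \<le> norm (S (e i))"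
    and A: "valid_randomized linear_functionals A" "ran_cardinality A \<le> of_nat n"
  shows "ennreal (s / 2) \<le> ran_error S A"
proof (cases "ran_error S A = \<top>")
  case True
  then show ?thesis by simp
next
  case False
  then obtain E where E: "ran_error S A = ennreal E" "0 \<le> E" by (cases "ran_error S A") auto
  define I :: "nat set" where "I = {..<4 * n}"
  define m where "m = real (4 * n)"
  \<comment> \<open>The choice gives \<open>16 * c * lam = m\<close>. Under this constraint the sum
    of \<open>lam * n\<close> times the zeroth moment and \<open>c\<close> times the second is least
    for \<open>lam = sqrt (2 / ((m + 2) * (m + 4)))\<close>. Here \<open>10 / 7\<close> approximates
    \<open>sqrt 2\<close>, and \<open>(m + 3)^2\<close> replaces
    \<open>(m + 2) * (m + 4)\<close>.\<close>
  define c where "c = 7 * m * (m + 3) / 160"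
  define lam where "lam = 10 / (7 * (m + 3))"
  have m: "4 \<le> m" using n by (simp add: m_def)
  have pos: "0 < m" "0 < c" "0 < lam" using m by (auto simp: c_def lam_def)
  have I: "finite I" "orthonormal_family e I" and card: "real (card I) = m"
    using e by (auto simp: I_def m_def)
  note [measurable] = affine_param_measurable[OF I(1)]
  let ?M = "space_of A" and ?f = "affine_param 0 e I"
  interpret P: prob_space ?M using A(1) by (simp add: valid_randomized_def)
  define T where "T = pseudo_inverse S e I"
  have lin: "linear (choose_functional A \<omega> ys)" if "\<omega> \<in> space ?M" for \<omega> ys
    using A(1) that by (auto simp: valid_randomized_def linear_functionals_def)
  have stops: "\<exists>k. stop_rule A \<omega> (info (choose_functional A \<omega>) f k)" if "\<omega> \<in> space ?M" for \<omega> f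
    using A(1) that by (auto simp: valid_randomized_def)
  have num [measurable]: "(\<lambda>z. num_used A (fst z) (snd z)) \<in> borel \<Otimes>\<^sub>M ?M \<rightarrow>\<^sub>M count_space UNIV"
    using A(1) by (simp add: valid_randomized_def case_prod_beta')
  have run [measurable]: "(\<lambda>z. run A (fst z) (snd z)) \<in> borel \<Otimes>\<^sub>M ?M \<rightarrow>\<^sub>M borel"
    using A(1) by (simp add: valid_randomized_def case_prod_beta')
  define err where "err = (\<lambda>f \<omega>. (norm (f - T (run A f \<omega>)))\<^sup>2)"
  define cost where "cost = (\<lambda>f \<omega>. ennreal (err f \<omega> + lam * real (num_used A f \<omega>) + c * (ball_weight f)\<^sup>2))"
  have err [measurable]: "(\<lambda>z. err (fst z) (snd z)) \<in> borel_measurable (borel \<Otimes>\<^sub>M ?M)"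
  proof -
    have run': "(\<lambda>z. inner (run A (fst z) (snd z)) v) \<in> borel_measurable (borel \<Otimes>\<^sub>M ?M)" for v
      by (rule measurable_compose[OF run borel_measurable_continuous_onI]) (intro continuous_intros)
    have in': "(\<lambda>z. inner (fst z) v) \<in> borel_measurable (borel \<Otimes>\<^sub>M ?M)" for v :: 'f
      by (rule measurable_compose[OF measurable_fst borel_measurable_continuous_onI]) (intro continuous_intros)
    have norm': "(\<lambda>z. (norm (fst z :: 'f))\<^sup>2) \<in> borel_measurable (borel \<Otimes>\<^sub>M ?M)"
      by (rule measurable_compose[OF measurable_fst borel_measurable_continuous_onI]) (intro continuous_intros)
    show ?thesis
      unfolding err_def T_def norm_diff_pseudo_inverse[OF I]
      by (intro borel_measurable_add borel_measurable_diff borel_measurable_sum borel_measurable_times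
          borel_measurable_divide borel_measurable_power borel_measurable_const run' in' norm')
  qed
  have weight [measurable]: "ball_weight \<in> borel_measurable (borel :: 'f measure)"
    by (rule borel_measurable_continuous_onI) (intro continuous_intros)
  have cost [measurable]: "(\<lambda>z. cost (fst z) (snd z)) \<in> borel_measurable (borel \<Otimes>\<^sub>M ?M)"
    unfolding cost_def by measurable
  \<comment> \<open>For a fixed input the error and cardinality bounds of the algorithm apply. The
    input has to lie in the span of the \<open>e i\<close>, where pulling back costs at most the
    factor \<open>1 / s^2\<close>.\<close>
  have average: "(\<integral>\<^sup>+\<omega>. cost f \<omega> \<partial>?M) \<le> ennreal (E\<^sup>2 / s\<^sup>2 + lam * real n) + ennreal (c * (ball_weight f)\<^sup>2)"
    if f: "f \<in> range ?f" "f \<in> unit_ball" for f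
  proof -
    have norm: "norm f < 1" using f(2) by (simp add: abs_square_less_1)
    have sec: "(\<lambda>\<omega>. (f, \<omega>)) \<in> ?M \<rightarrow>\<^sub>M borel \<Otimes>\<^sub>M ?M" by (rule measurable_Pair1') simp
    have [measurable]: "(\<lambda>\<omega>. err f \<omega>) \<in> borel_measurable ?M"
      using measurable_compose[OF sec err] by simp
    have [measurable]: "(\<lambda>\<omega>. num_used A f \<omega>) \<in> ?M \<rightarrow>\<^sub>M count_space UNIV"
      using measurable_compose[OF sec num] by simp
    have run_f: "(\<lambda>\<omega>. run A f \<omega>) \<in> borel_measurable ?M"
      using measurable_compose[OF sec run] by simp
    have [measurable]: "(\<lambda>\<omega>. ennreal ((norm (S f - run A f \<omega>))\<^sup>2)) \<in> borel_measurable ?M"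
      by (rule measurable_compose[OF run_f borel_measurable_ennreal_continuous]) (intro continuous_intros)
    have "(\<integral>\<^sup>+\<omega>. cost f \<omega> \<partial>?M) = (\<integral>\<^sup>+\<omega>. (ennreal (err f \<omega>) + ennreal lam * of_nat (num_used A f \<omega>)) + ennreal (c * (ball_weight f)\<^sup>2) \<partial>?M)"
      using pos unfolding cost_def
      by (intro nn_integral_cong) (simp add: ennreal_plus err_def ennreal_mult ennreal_of_nat_eq_real_of_nat)
    also have "\<dots> = (\<integral>\<^sup>+\<omega>. ennreal (err f \<omega>) \<partial>?M) + ennreal lam * (\<integral>\<^sup>+\<omega>. of_nat (num_used A f \<omega>) \<partial>?M)
        + ennreal (c * (ball_weight f)\<^sup>2)"
      by (simp add: nn_integral_add nn_integral_cmult P.emeasure_space_1)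
    also have "\<dots> \<le> (ennreal (E\<^sup>2 / s\<^sup>2) + ennreal lam * of_nat n) + ennreal (c * (ball_weight f)\<^sup>2)"
    proof (intro add_mono mult_left_mono order_refl)
      have "(\<integral>\<^sup>+\<omega>. of_nat (num_used A f \<omega>) \<partial>?M) \<le> ran_cardinality A"
        unfolding ran_cardinality_def by (rule SUP_upper) (simp add: norm)
      then show "(\<integral>\<^sup>+\<omega>. of_nat (num_used A f \<omega>) \<partial>?M) \<le> of_nat n" using A(2) by (rule order_trans)
      have "ennreal_sqrt (\<integral>\<^sup>+\<omega>. ennreal ((norm (S f - run A f \<omega>))\<^sup>2) \<partial>?M) \<le> ennreal E"
        unfolding E(1)[symmetric] ran_error_def by (rule SUP_upper) (simp add: norm)
      then have le: "(\<integral>\<^sup>+\<omega>. ennreal ((norm (S f - run A f \<omega>))\<^sup>2) \<partial>?M) \<le> ennreal (E\<^sup>2)"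
        by (rule ennreal_sqrt_le_imp) (rule E)
      obtain x where x: "f = ?f x" using f(1) by auto
      have "(\<integral>\<^sup>+\<omega>. ennreal (err f \<omega>) \<partial>?M) \<le> (\<integral>\<^sup>+\<omega>. ennreal (1 / s\<^sup>2) * ennreal ((norm (S f - run A f \<omega>))\<^sup>2) \<partial>?M)"
      proof (rule nn_integral_mono)
        fix \<omega>
        have "s\<^sup>2 * err f \<omega> \<le> (norm (S f - run A f \<omega>))\<^sup>2"
          unfolding err_def T_def x
          by (rule pseudo_inverse_error[OF S I]) (use orth s in \<open>auto simp: I_def\<close>)
        then have "err f \<omega> \<le> 1 / s\<^sup>2 * (norm (S f - run A f \<omega>))\<^sup>2"
          using s by (simp add: field_simps)
        then show "ennreal (err f \<omega>) \<le> ennreal (1 / s\<^sup>2) * ennreal ((norm (S f - run A f \<omega>))\<^sup>2)"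
          by (simp add: ennreal_leI flip: ennreal_mult)
      qed
      also have "\<dots> = ennreal (1 / s\<^sup>2) * (\<integral>\<^sup>+\<omega>. ennreal ((norm (S f - run A f \<omega>))\<^sup>2) \<partial>?M)"
        by (rule nn_integral_cmult) measurable
      also have "\<dots> \<le> ennreal (1 / s\<^sup>2) * ennreal (E\<^sup>2)"
        using le by (rule mult_left_mono) simp
      also have "\<dots> = ennreal (E\<^sup>2 / s\<^sup>2)"
        by (simp flip: ennreal_mult)
      finally show "(\<integral>\<^sup>+\<omega>. ennreal (err f \<omega>) \<partial>?M) \<le> ennreal (E\<^sup>2 / s\<^sup>2)" .
    qed simp_all
    also have "ennreal (E\<^sup>2 / s\<^sup>2) + ennreal lam * of_nat n = ennreal (E\<^sup>2 / s\<^sup>2 + lam * real n)"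
      using pos by (simp add: ennreal_plus ennreal_mult ennreal_of_nat_eq_real_of_nat)
    finally show ?thesis .
  qed
  \<comment> \<open>For a fixed \<open>\<omega>\<close> the adaptive bound starts from the empty
    history and the full span, whose dimension is exactly \<open>m\<close>.\<close>
  have bayes: "(\<integral>\<^sup>+x. ennreal (m / 2 * ball_weight (?f x)) \<partial>coord_lborel I) \<le>
      (\<integral>\<^sup>+x. cost (?f x) \<omega> * indicator unit_ball (?f x) \<partial>coord_lborel I)" if \<omega>: "\<omega> \<in> space ?M" for \<omega>
  proof -
    have sec: "(\<lambda>f. (f, \<omega>)) \<in> borel \<rightarrow>\<^sub>M borel \<Otimes>\<^sub>M ?M" by (rule measurable_Pair2'[OF \<omega>])
    have meas: "(\<lambda>f. cost f \<omega>) \<in> borel_measurable borel"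
      using measurable_compose[OF sec cost] by simp
    show ?thesis
      unfolding cost_def err_def run_def
    proof (rule adaptive_bayes_bound[where stop = "stop_rule A \<omega>" and L = "choose_functional A \<omega>"
          and out = "\<lambda>ys. T (output_map A \<omega> ys)" and h = "[]" and j = 0])
      show "linear (choose_functional A \<omega> ys)" for ys by (rule lin[OF \<omega>])
      show "stop_rule A \<omega> (info (choose_functional A \<omega>) f (num_used A f \<omega>))" for f
        unfolding num_used_def using stops[OF \<omega>, of f] by (rule LeastI_ex)
      show "\<not> stop_rule A \<omega> (info (choose_functional A \<omega>) f i)" if "i < num_used A f \<omega>" for f i
        using that unfolding num_used_def by (rule not_less_Least)
      show "(\<lambda>f. ennreal ((norm (f - T (output_map A \<omega> (info (choose_functional A \<omega>) f (num_used A f \<omega>)))))\<^sup>2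
          + lam * real (num_used A f \<omega>) + c * (ball_weight f)\<^sup>2)) \<in> borel_measurable borel"
        using meas unfolding cost_def err_def run_def .
      show "m \<le> 16 * c * lam" using m by (simp add: c_def lam_def field_simps)
      show "indep_family e I" by (rule orthonormal_imp_indep[OF I])
    qed (use pos I card in auto)
  qed
  have sf: "pair_sigma_finite (coord_lborel I) ?M"
    by (intro pair_sigma_finite.intro lborel_prod.sigma_finite I P.sigma_finite_measure_axioms)
  \<comment> \<open>The left side is free of \<open>\<omega>\<close>, so it may be averaged over the
    probability space and compared for each \<open>\<omega>\<close> separately.\<close>
  have "(\<integral>\<^sup>+x. ennreal (m / 2 * ball_weight (?f x)) \<partial>coord_lborel I) =
      (\<integral>\<^sup>+\<omega>. (\<integral>\<^sup>+x. ennreal (m / 2 * ball_weight (?f x)) \<partial>coord_lborel I) \<partial>?M)"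
    by (simp add: P.emeasure_space_1)
  also have "\<dots> \<le> (\<integral>\<^sup>+\<omega>. (\<integral>\<^sup>+x. cost (?f x) \<omega> * indicator unit_ball (?f x) \<partial>coord_lborel I) \<partial>?M)"
    by (rule nn_integral_mono) (rule bayes)
  \<comment> \<open>Exchanging the integrals passes from bounds at fixed \<open>\<omega>\<close> to
    bounds at a fixed input.\<close>
  also have "\<dots> = (\<integral>\<^sup>+x. (\<integral>\<^sup>+\<omega>. cost (?f x) \<omega> * indicator unit_ball (?f x) \<partial>?M) \<partial>coord_lborel I)"
  proof (rule pair_sigma_finite.Fubini'[OF sf])
    have pr: "(\<lambda>z. (?f (fst z), snd z)) \<in> coord_lborel I \<Otimes>\<^sub>M ?M \<rightarrow>\<^sub>M borel \<Otimes>\<^sub>M ?M"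
      by measurable
    have [measurable]: "(\<lambda>z. cost (?f (fst z)) (snd z)) \<in> borel_measurable (coord_lborel I \<Otimes>\<^sub>M ?M)"
      using measurable_compose[OF pr cost] by simp
    show "(\<lambda>(x, \<omega>). cost (?f x) \<omega> * indicator unit_ball (?f x)) \<in> borel_measurable (coord_lborel I \<Otimes>\<^sub>M ?M)"
      unfolding case_prod_beta' by measurable
  qed
  also have "\<dots> \<le> (\<integral>\<^sup>+x. ennreal (E\<^sup>2 / s\<^sup>2 + lam * real n) * (ennreal (ball_weight (?f x) ^ 0) * indicator unit_ball (?f x)) +
      ennreal c * (ennreal (ball_weight (?f x) ^ 2) * indicator unit_ball (?f x)) \<partial>coord_lborel I)"
  proof (rule nn_integral_mono)
    fix x
    show "(\<integral>\<^sup>+\<omega>. cost (?f x) \<omega> * indicator unit_ball (?f x) \<partial>?M) \<le>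
      ennreal (E\<^sup>2 / s\<^sup>2 + lam * real n) * (ennreal (ball_weight (?f x) ^ 0) * indicator unit_ball (?f x)) +
      ennreal c * (ennreal (ball_weight (?f x) ^ 2) * indicator unit_ball (?f x))"
    proof (cases "?f x \<in> unit_ball")
      case True
      then have ind: "indicator unit_ball (?f x) = (1::ennreal)" by simp
      have "ennreal c * ennreal (ball_weight (?f x) ^ 2) = ennreal (c * ball_weight (?f x) ^ 2)"
        using pos by (simp add: ennreal_mult)
      then show ?thesis
        using average[OF rangeI True] unfolding ind by (simp only: mult_1_right power_0 ennreal_1)
    next
      case False
      then show ?thesis by simp
    qed
  qed
  also have "\<dots> = ennreal (E\<^sup>2 / s\<^sup>2 + lam * real n) * ball_moment e I 0 + ennreal c * ball_moment e I 2"
  proof -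
    define U where "U p x = ennreal (ball_weight (?f x) ^ p) * indicator unit_ball (?f x)" for p x
    have [measurable]: "U p \<in> borel_measurable (coord_lborel I)" for p
      unfolding U_def by measurable
    show ?thesis
      unfolding ball_moment_def U_def[symmetric]
      by (subst nn_integral_add) (simp_all add: nn_integral_cmult)
  qed
  finally have *: "(\<integral>\<^sup>+x. ennreal (m / 2 * ball_weight (?f x)) \<partial>coord_lborel I) \<le> \<dots>" .
  have "(\<integral>\<^sup>+x. ennreal (m / 2 * ball_weight (?f x)) \<partial>coord_lborel I) =
      (\<integral>\<^sup>+x. ennreal (m / 2) * (ennreal (ball_weight (?f x) ^ 1) * indicator unit_ball (?f x)) \<partial>coord_lborel I)"
  proof (rule nn_integral_cong)
    fix x
    show "ennreal (m / 2 * ball_weight (?f x)) = ennreal (m / 2) * (ennreal (ball_weight (?f x) ^ 1) * indicator unit_ball (?f x))"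
    proof (cases "?f x \<in> unit_ball")
      case True
      then show ?thesis using pos by (simp add: ennreal_mult[symmetric] ball_weight_bounds(1))
    next
      case False
      then show ?thesis by (simp add: ball_weight_bounds(3))
    qed
  qed
  also have "\<dots> = ennreal (m / 2) * ball_moment e I 1"
    unfolding ball_moment_def by (rule nn_integral_cmult) measurable
  finally have main: "ennreal (m / 2) * ball_moment e I 1 \<le>
      ennreal (E\<^sup>2 / s\<^sup>2 + lam * real n) * ball_moment e I 0 + ennreal c * ball_moment e I 2"
    using * by simp
  have M1: "ball_moment e I 1 = ennreal (1 + m / 4) * ball_moment e I 2"
    using ball_moment_recursion[OF I, of 2] by (simp add: card)
  have M0: "ball_moment e I 0 = ennreal (1 + m / 2) * ball_moment e I 1"
    using ball_moment_recursion[OF I, of 1] by (simp add: card)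
  have M0': "ball_moment e I 0 = ennreal ((1 + m / 2) * (1 + m / 4)) * ball_moment e I 2"
    unfolding M0 M1 using m by (simp add: ennreal_mult mult.assoc)
  \<comment> \<open>The second moment is a positive multiple of the volume up to inversion, hence
    finite and nonzero, and can be cancelled.\<close>
  have "ball_moment e I 2 \<noteq> \<top>"
    using ball_moment_zero_bounds(2)[OF I] m unfolding M0' by (auto simp: ennreal_mult_top)
  then obtain v where v: "ball_moment e I 2 = ennreal v" "0 \<le> v" by (cases "ball_moment e I 2") auto
  have "v \<noteq> 0" using ball_moment_zero_bounds(1)[OF I] unfolding M0' v by auto
  then have v0: "0 < v" using v by simp
  define y where "y = E\<^sup>2 / s\<^sup>2"
  have y: "0 \<le> y" by (simp add: y_def)
  have "ennreal (m / 2 * ((1 + m / 4) * v)) \<le> ennreal ((y + lam * real n) * ((1 + m / 2) * (1 + m / 4) * v) + c * v)"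
    using main pos m v y unfolding M0' M1 v y_def[symmetric]
    by (simp add: ennreal_mult[symmetric] ennreal_plus[symmetric] del: ennreal_plus)
  then have "m / 2 * ((1 + m / 4) * v) \<le> (y + lam * real n) * ((1 + m / 2) * (1 + m / 4) * v) + c * v"
    by (subst (asm) ennreal_le_iff) (use pos m v y in auto)
  then have "(m / 2 * (1 + m / 4)) * v \<le> ((y + lam * real n) * ((1 + m / 2) * (1 + m / 4)) + c) * v"
    by (simp add: algebra_simps)
  then have "m / 2 * (1 + m / 4) \<le> (y + lam * real n) * ((1 + m / 2) * (1 + m / 4)) + c"
    using v0 by (rule mult_right_le_imp_le)
  then have "1 / 4 \<le> y"
    using prior_arithmetic[OF m, of y] unfolding c_def lam_def by (simp add: m_def)
  then have "(s / 2)\<^sup>2 \<le> E\<^sup>2" using s by (simp add: y_def power_divide field_simps)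
  then have "s / 2 \<le> E" using E(2) by (rule power2_le_imp_le)
  then show ?thesis unfolding E by (rule ennreal_leI)
qed

section \<open>Singular systems of compact operators\<close>

lemma compact_linear_operator_bounded_linear:
  assumes "compact_linear_operator S"
  shows "bounded_linear S"
proof -
  have "bounded (S ` cball 0 1)"
    using assms bounded_cball compact_imp_bounded bounded_subset closure_subset
    unfolding compact_linear_operator_def by metis
  then obtain B where B: "norm (S f) \<le> B" if "norm f \<le> 1" for f
    unfolding bounded_iff by (metis dist_0_norm image_eqI mem_cball)
  have lin: "linear S" using assms by (simp add: compact_linear_operator_def)
  show ?thesis
  proof (rule bounded_linear_intro)
    show "S (x + y) = S x + S y" "S (r *\<^sub>R x) = r *\<^sub>R S x" for x y r
      using lin by (simp_all add: linear_add linear_cmul)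
    show "norm (S x) \<le> norm x * B" for x
    proof (cases "x = 0")
      case True
      then show ?thesis using linear_0[OF lin] by simp
    next
      case False
      have "norm (S ((1 / norm x) *\<^sub>R x)) \<le> B" by (rule B) (use False in simp)
      then show ?thesis using False by (simp add: linear_cmul[OF lin] field_simps)
    qed
  qed
qed

lemma exists_maximizing_vector:
  fixes S :: "'f::{real_inner, banach} \<Rightarrow> 'g::real_inner"
  assumes S: "compact_linear_operator S" and K: "subspace K" "closed K"
  shows "\<exists>e\<in>K. (norm e = 1 \<or> e = 0) \<and> (\<forall>f\<in>K. norm (S f) \<le> norm (S e) * norm f)"
proof (cases "\<forall>f\<in>K. S f = 0")
  case True
  then show ?thesis using subspace_0[OF K(1)] by auto
next
  case False
  interpret S: bounded_linear S by (rule compact_linear_operator_bounded_linear[OF S])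
  define U where "U = {f \<in> K. norm f = 1}"
  define s where "s = (SUP f\<in>U. norm (S f))"
  obtain B where B: "norm (S f) \<le> norm f * B" for f using S.bounded by blast
  have bdd: "bdd_above ((\<lambda>f. norm (S f)) ` U)"
    using B unfolding U_def by (intro bdd_aboveI[of _ B]) (auto, metis mult_1)
  have upper: "norm (S f) \<le> s * norm f" if "f \<in> K" for f
  proof (cases "f = 0")
    case True
    then show ?thesis by (simp add: S.zero)
  next
    case False
    then have "(1 / norm f) *\<^sub>R f \<in> U" using that K by (simp add: U_def subspace_scale)
    then have "norm (S ((1 / norm f) *\<^sub>R f)) \<le> s" unfolding s_def by (rule cSUP_upper[OF _ bdd])
    then show ?thesis using False by (simp add: S.scaleR field_simps)
  qed
  obtain f0 where f0: "f0 \<in> K" "S f0 \<noteq> 0" using False by blast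
  then have "f0 \<noteq> 0" using S.zero by auto
  then have "(1 / norm f0) *\<^sub>R f0 \<in> U" using f0 K by (simp add: U_def subspace_scale)
  then have U: "U \<noteq> {}" by blast
  have s: "0 < s"
  proof -
    have "0 < norm (S f0)" using f0 by simp
    also have "\<dots> \<le> s * norm f0" by (rule upper[OF f0(1)])
    finally show ?thesis by (simp add: zero_less_mult_iff)
  qed
  have "\<exists>f\<in>U. s - 1 / Suc n < norm (S f)" for n
    using less_cSUP_iff[OF U bdd, of "s - 1 / Suc n"] unfolding s_def by simp
  then obtain u where u: "u n \<in> U" "s - 1 / Suc n < norm (S (u n))" for n by metis
  have "compact (closure (S ` U))"
  proof -
    have "bounded U" unfolding U_def bounded_iff by (intro exI[of _ 1]) auto
    then show ?thesis using S by (simp add: compact_linear_operator_def)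
  qed
  then obtain g r where r: "strict_mono r" "((\<lambda>n. S (u n)) \<circ> r) \<longlonglongrightarrow> g"
    using u(1) closure_subset unfolding compact_def by (metis image_eqI subsetD)
  define v where "v = u \<circ> r"
  have v: "v n \<in> U" for n using u by (simp add: v_def)
  then have vK: "v n \<in> K" "norm (v n) = 1" for n by (auto simp: U_def)
  have Sv: "(\<lambda>n. S (v n)) \<longlonglongrightarrow> g" using r by (simp add: v_def o_def)
  have norm_Sv: "(\<lambda>n. norm (S (v n))) \<longlonglongrightarrow> s"
  proof (rule tendsto_sandwich)
    show "\<forall>\<^sub>F n in sequentially. s - 1 / Suc (r n) \<le> norm (S (v n))"
      using u(2) by (auto simp: v_def intro!: always_eventually less_imp_le)
    show "\<forall>\<^sub>F n in sequentially. norm (S (v n)) \<le> s"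
      using upper[OF vK(1)] vK(2) by (auto intro!: always_eventually)
    have "(\<lambda>n. 1 / Suc (r n)) \<longlonglongrightarrow> 0"
      using LIMSEQ_subseq_LIMSEQ[OF LIMSEQ_inverse_real_of_nat r(1)] by (simp add: o_def inverse_eq_divide)
    from tendsto_diff[OF tendsto_const this, of s]
    show "(\<lambda>n. s - 1 / Suc (r n)) \<longlonglongrightarrow> s" by simp
  qed simp
  have norm_g: "norm g = s"
    using LIMSEQ_unique[OF tendsto_norm[OF Sv] norm_Sv] .
  \<comment> \<open>Since \<open>S (v n)\<close> converges to a vector of maximal norm, \<open>v p + v q\<close> has norm close to 2,
    and the parallelogram law makes \<open>v p - v q\<close> small.\<close>
  have "Cauchy v"
  proof (rule CauchyI)
    fix \<epsilon> :: real assume \<epsilon>: "0 < \<epsilon>"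
    \<comment> \<open>Two image errors below \<open>d\<close> sum to less than
      \<open>s * \<epsilon>^2 / 4\<close>. Dividing by \<open>s\<close> and multiplying by 4, a
      bound for \<open>2 + norm (v p + v q)\<close>, gives \<open>\<epsilon>^2\<close>.\<close>
    define d where "d = s * \<epsilon>\<^sup>2 / 8"
    have d: "0 < d" using s \<epsilon> by (simp add: d_def)
    obtain N where N: "norm (S (v n) - g) < d" if "n \<ge> N" for n
      using LIMSEQ_D[OF Sv d] by blast
    have "norm (v p - v q) < \<epsilon>" if pq: "p \<ge> N" "q \<ge> N" for p q
    proof -
      have "norm (2 *\<^sub>R g) \<le> norm (S (v p + v q)) + norm ((g - S (v p)) + (g - S (v q)))"
        using norm_triangle_ineq[of "S (v p + v q)" "(g - S (v p)) + (g - S (v q))"]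
        by (simp add: S.add scaleR_2 algebra_simps)
      also have "norm ((g - S (v p)) + (g - S (v q))) \<le> norm (S (v p) - g) + norm (S (v q) - g)"
        using norm_triangle_ineq by (metis norm_minus_commute)
      also have "norm (S (v p + v q)) \<le> s * norm (v p + v q)"
        by (rule upper) (use vK K in \<open>simp add: subspace_add\<close>)
      finally have "2 * s \<le> s * norm (v p + v q) + norm (S (v p) - g) + norm (S (v q) - g)"
        by (simp add: norm_g)
      then have "2 * s < s * norm (v p + v q) + 2 * d" using N[OF pq(1)] N[OF pq(2)] by linarith
      then have "s * (2 - norm (v p + v q)) < s * (\<epsilon>\<^sup>2 / 4)" by (simp add: d_def algebra_simps)
      then have close: "2 - norm (v p + v q) < \<epsilon>\<^sup>2 / 4" using s by simp
      have le2: "norm (v p + v q) \<le> 2" using norm_triangle_ineq[of "v p" "v q"] vK by simp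
      have "(norm (v p - v q))\<^sup>2 = 4 - (norm (v p + v q))\<^sup>2"
        using vK[of p] vK[of q]
        by (simp add: power2_norm_eq_inner inner_add_left inner_add_right inner_diff_left inner_diff_right
            inner_commute norm_eq_1)
      also have "\<dots> = (2 - norm (v p + v q)) * (2 + norm (v p + v q))"
        by (simp add: power2_eq_square algebra_simps)
      also have "\<dots> \<le> (2 - norm (v p + v q)) * 4"
        using le2 by (intro mult_left_mono) auto
      also have "\<dots> < \<epsilon>\<^sup>2" using close by simp
      finally show ?thesis using \<epsilon> by (metis less_imp_le power2_less_imp_less)
    qed
    then show "\<exists>M. \<forall>m\<ge>M. \<forall>n\<ge>M. norm (v m - v n) < \<epsilon>" by blast
  qed
  then obtain e where e: "v \<longlonglongrightarrow> e" using Cauchy_convergent_iff convergent_def by blast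
  have "e \<in> K" using K(2) e vK(1) by (meson closed_sequentially)
  moreover have "norm e = 1"
    using LIMSEQ_unique[OF tendsto_norm[OF e]] vK(2) by simp
  moreover have "S e = g" using LIMSEQ_unique[OF S.tendsto[OF e] Sv] .
  ultimately show ?thesis using norm_g upper by auto
qed

text \<open>First variation: moving \<open>e\<close> by \<open>t *\<^sub>R f\<close> changes the
  norm of the vector only to second order, so the first-order change of the norm of its image must
  vanish.\<close>

lemma maximizer_orthogonal:
  fixes S :: "'f::real_inner \<Rightarrow> 'g::real_inner"
  assumes S: "linear S" and K: "subspace K" "e \<in> K" "f \<in> K" and ef: "inner e f = 0"
    and e: "norm e = 1 \<or> e = 0" and max: "\<And>f. f \<in> K \<Longrightarrow> norm (S f) \<le> norm (S e) * norm f"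
  shows "inner (S e) (S f) = 0"
proof (cases "e = 0")
  case True
  then show ?thesis using linear_0[OF S] by simp
next
  case False
  then have e1: "norm e = 1" using e by blast
  define p where "p = inner (S e) (S f)"
  define C where "C = (norm (S e))\<^sup>2 * (norm f)\<^sup>2"
  have bound: "2 * t * p \<le> C * t\<^sup>2" for t
  proof -
    have "e + t *\<^sub>R f \<in> K" using K by (simp add: subspace_add subspace_scale)
    then have "(norm (S (e + t *\<^sub>R f)))\<^sup>2 \<le> (norm (S e) * norm (e + t *\<^sub>R f))\<^sup>2"
      using max by (intro power_mono) auto
    also have "\<dots> = (norm (S e))\<^sup>2 * (norm (e + t *\<^sub>R f))\<^sup>2" by (rule power_mult_distrib)
    also have "(norm (e + t *\<^sub>R f))\<^sup>2 = 1 + t\<^sup>2 * (norm f)\<^sup>2"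
      using e1 ef unfolding norm_eq_1 power2_norm_eq_inner
      by (simp add: inner_add_left inner_add_right inner_commute[of f e] power2_eq_square)
    also have "(norm (S (e + t *\<^sub>R f)))\<^sup>2 = (norm (S e))\<^sup>2 + 2 * t * p + t\<^sup>2 * (norm (S f))\<^sup>2"
      unfolding power2_norm_eq_inner linear_add[OF S] linear_cmul[OF S]
      by (simp add: inner_add_left inner_add_right inner_commute[of "S f" "S e"] p_def power2_eq_square algebra_simps)
    finally have "2 * t * p + t\<^sup>2 * (norm (S f))\<^sup>2 \<le> C * t\<^sup>2" by (simp add: C_def algebra_simps)
    moreover have "0 \<le> t\<^sup>2 * (norm (S f))\<^sup>2" by simp
    ultimately show ?thesis by linarith
  qed
  have C: "0 \<le> C" by (simp add: C_def)
  \<comment> \<open>The minimiser \<open>p / C\<close> of the quadratic is avoided because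
    \<open>C\<close> may be 0; with \<open>C + 1\<close> the bound still reduces to
    \<open>p^2 * (C + 2) \<le> 0\<close>.\<close>
  define t where "t = p / (C + 1)"
  have tC: "t * (C + 1) = p" using C by (simp add: t_def)
  have "2 * t * p * (C + 1)\<^sup>2 \<le> C * t\<^sup>2 * (C + 1)\<^sup>2"
    by (rule mult_right_mono[OF bound]) simp
  also have "2 * t * p * (C + 1)\<^sup>2 = 2 * p * (t * (C + 1)) * (C + 1)"
    by (simp add: power2_eq_square)
  also have "C * t\<^sup>2 * (C + 1)\<^sup>2 = C * (t * (C + 1))\<^sup>2"
    by (simp only: power_mult_distrib mult.assoc)
  finally have "2 * p\<^sup>2 * (C + 1) \<le> C * p\<^sup>2" unfolding tC by (simp add: power2_eq_square)
  then have "p\<^sup>2 * (C + 2) \<le> 0" by (simp add: algebra_simps)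
  then have "p\<^sup>2 \<le> 0" using C by (simp add: mult_le_0_iff)
  then show ?thesis by (simp add: p_def)
qed

section \<open>Greedy singular systems\<close>

definition orthogonal_to_first :: "(nat \<Rightarrow> 'f::real_inner) \<Rightarrow> nat \<Rightarrow> 'f set" where
  "orthogonal_to_first e n = {f. \<forall>j<n. inner (e j) f = 0}"

lemma subspace_orthogonal_to_first: "subspace (orthogonal_to_first e n)"
  by (rule subspaceI) (simp_all add: orthogonal_to_first_def inner_add_right)

lemma closed_orthogonal_to_first: "closed (orthogonal_to_first e n)"
  unfolding orthogonal_to_first_def
  by (intro closed_Collect_all closed_Collect_imp open_Collect_const closed_Collect_eq continuous_intros)

text \<open>Right singular vectors described by their extremal property instead of an eigenvalue
  equation. If \<open>e n = 0\<close>, the inequality says that \<open>S\<close> vanishes on the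
  remaining orthogonal complement.\<close>

definition singular_system :: "('f::real_inner \<Rightarrow> 'g::real_inner) \<Rightarrow> (nat \<Rightarrow> 'f) \<Rightarrow> bool" where
  "singular_system S e \<longleftrightarrow> (\<forall>n. e n \<in> orthogonal_to_first e n \<and> (norm (e n) = 1 \<or> e n = 0) \<and>
     (\<forall>f\<in>orthogonal_to_first e n. norm (S f) \<le> norm (S (e n)) * norm f))"

text \<open>The requirement on \<open>e n\<close> involves earlier vectors only, so dependent choice
  along the order of the naturals applies.\<close>

lemma singular_system_exists:
  fixes S :: "'f::{real_inner, banach} \<Rightarrow> 'g::real_inner"
  assumes "compact_linear_operator S"
  shows "\<exists>e. singular_system S e"
  unfolding singular_system_def
proof (rule dependent_wellorder_choice)
  fix r and e e' :: "nat \<Rightarrow> 'f" and n :: nat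
  assume "\<And>j. j < n \<Longrightarrow> e j = e' j"
  then have "orthogonal_to_first e n = orthogonal_to_first e' n" by (simp add: orthogonal_to_first_def)
  then show "(r \<in> orthogonal_to_first e n \<and> (norm r = 1 \<or> r = 0) \<and>
      (\<forall>f\<in>orthogonal_to_first e n. norm (S f) \<le> norm (S r) * norm f)) =
    (r \<in> orthogonal_to_first e' n \<and> (norm r = 1 \<or> r = 0) \<and>
      (\<forall>f\<in>orthogonal_to_first e' n. norm (S f) \<le> norm (S r) * norm f))" by simp
next
  fix n and e :: "nat \<Rightarrow> 'f"
  show "\<exists>r. r \<in> orthogonal_to_first e n \<and> (norm r = 1 \<or> r = 0) \<and>
      (\<forall>f\<in>orthogonal_to_first e n. norm (S f) \<le> norm (S r) * norm f)"
    using exists_maximizing_vector[OF assms subspace_orthogonal_to_first closed_orthogonal_to_first] by blast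
qed

context
  fixes S :: "'f::real_inner \<Rightarrow> 'g::real_inner" and e :: "nat \<Rightarrow> 'f"
  assumes S: "linear S" and e: "singular_system S e"
begin

lemma singular_bound: "f \<in> orthogonal_to_first e n \<Longrightarrow> norm (S f) \<le> norm (S (e n)) * norm f"
  using e by (simp add: singular_system_def)

lemma singular_unit: "norm (e n) = 1 \<or> e n = 0"
  using e by (simp add: singular_system_def)

lemma singular_mem: "n \<le> k \<Longrightarrow> e k \<in> orthogonal_to_first e n"
  using e by (force simp: singular_system_def orthogonal_to_first_def)

lemma singular_orthogonal: "i \<noteq> j \<Longrightarrow> inner (e i) (e j) = 0"
  using singular_mem[of "Suc i" j] singular_mem[of "Suc j" i]
  by (cases "i < j") (auto simp: orthogonal_to_first_def inner_commute)

lemma singular_antimono: "i \<le> j \<Longrightarrow> norm (S (e j)) \<le> norm (S (e i))"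
  using singular_bound[OF singular_mem, of i j] singular_unit[of j] linear_0[OF S] by auto

lemma singular_image_orthogonal: "i \<noteq> j \<Longrightarrow> inner (S (e i)) (S (e j)) = 0"
proof (induction i j rule: linorder_wlog)
  case (le i j)
  show ?case
    by (rule maximizer_orthogonal[OF S subspace_orthogonal_to_first[of e i]])
       (use le singular_mem singular_orthogonal singular_unit singular_bound in auto)
qed (simp add: inner_commute)

text \<open>The values \<open>norm (S (e i))\<close> decrease, so all are positive up to
  \<open>n\<close>, which rules out zero vectors among the first \<open>n + 1\<close>.\<close>

lemma singular_orthonormal:
  assumes "0 < norm (S (e n))"
  shows "orthonormal_family e {..n}"
  unfolding orthonormal_family_def
proof (intro ballI)
  fix i j assume "i \<in> {..n}" "j \<in> {..n}"
  then have "0 < norm (S (e i))" using less_le_trans[OF assms singular_antimono] by simp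
  then have "norm (e i) = 1" using singular_unit[of i] linear_0[OF S] by auto
  then show "inner (e i) (e j) = (if i = j then 1 else 0)"
    using singular_orthogonal[of i j] by (cases "i = j") (auto simp: norm_eq_1)
qed

definition singular_truncation :: "nat \<Rightarrow> 'f \<Rightarrow> 'g" where
  "singular_truncation n f = (\<Sum>i<n. inner (e i) f *\<^sub>R S (e i))"

text \<open>The truncation is \<open>S\<close> applied to the orthogonal projection \<open>p\<close>
  of \<open>f\<close>. The remainder \<open>f - p\<close> is orthogonal to the first
  \<open>n\<close> vectors and no longer than \<open>f\<close>, so the extremal property of
  \<open>e n\<close> applies to it.\<close>

lemma singular_truncation_error: "norm (S f - singular_truncation n f) \<le> norm (S (e n)) * norm f"
proof -
  define p where "p = (\<Sum>i<n. inner (e i) f *\<^sub>R e i)"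
  have "inner (e j) p = inner (e j) f" if "j < n" for j
  proof -
    have "inner (e j) p = (\<Sum>i<n. inner (e i) f * inner (e j) (e i))"
      by (simp add: p_def inner_sum_right)
    also have "\<dots> = (\<Sum>i<n. if i = j then inner (e j) f * inner (e j) (e j) else 0)"
      by (rule sum.cong) (use singular_orthogonal in auto)
    \<comment> \<open>If \<open>e j = 0\<close>, both sides are 0; otherwise \<open>e j\<close> is a
      unit vector.\<close>
    also have "\<dots> = inner (e j) f" using that singular_unit[of j] by (auto simp: norm_eq_1)
    finally show ?thesis .
  qed
  then have mem: "f - p \<in> orthogonal_to_first e n"
    by (simp add: orthogonal_to_first_def inner_diff_right)
  have "inner p (f - p) = 0"
    unfolding p_def inner_sum_left using mem[unfolded p_def]
    by (intro sum.neutral) (simp add: orthogonal_to_first_def)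
  then have "(norm f)\<^sup>2 = (norm p)\<^sup>2 + (norm (f - p))\<^sup>2"
    by (simp add: power2_norm_eq_inner inner_diff_left inner_diff_right inner_commute)
  then have "(norm (f - p))\<^sup>2 \<le> (norm f)\<^sup>2" by simp
  then have "norm (f - p) \<le> norm f" by (rule power2_le_imp_le) simp
  then have "norm (S (e n)) * norm (f - p) \<le> norm (S (e n)) * norm f" by (rule mult_left_mono) simp
  with singular_bound[OF mem] have "norm (S (f - p)) \<le> norm (S (e n)) * norm f" by linarith
  moreover have "S (f - p) = S f - singular_truncation n f"
    by (simp add: p_def singular_truncation_def linear_diff[OF S] linear_sum[OF S] linear_cmul[OF S])
  ultimately show ?thesis by simp
qed

end

section \<open>Minimal errors\<close>

text \<open>Gaussian elimination: a homogeneous system with fewer equations than unknowns has a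
  nonzero solution. Equation \<open>n\<close> serves as pivot to eliminate one unknown, unless its
  coefficients all vanish.\<close>

lemma common_kernel:
  fixes l :: "nat \<Rightarrow> nat \<Rightarrow> real"
  assumes "finite I" "n < card I"
  shows "\<exists>x. (\<exists>i\<in>I. x i \<noteq> 0) \<and> (\<forall>j<n. (\<Sum>i\<in>I. x i * l j i) = 0)"
  using assms
proof (induction n arbitrary: I l)
  case 0
  then have "I \<noteq> {}" by auto
  then show ?case by (intro exI[of _ "\<lambda>_. 1"]) auto
next
  case (Suc n)
  show ?case
  proof (cases "\<forall>i\<in>I. l n i = 0")
    case True
    obtain x where x: "\<exists>i\<in>I. x i \<noteq> 0" "\<forall>j<n. (\<Sum>i\<in>I. x i * l j i) = 0"
      using Suc.IH[of I l, OF Suc.prems(1) Suc_lessD[OF Suc.prems(2)]] by blast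
    have "(\<Sum>i\<in>I. x i * l n i) = 0" by (rule sum.neutral) (simp add: True)
    then have "\<forall>j<Suc n. (\<Sum>i\<in>I. x i * l j i) = 0" using x(2) by (simp add: less_Suc_eq)
    then show ?thesis using x(1) by blast
  next
    case False
    then obtain i where i: "i \<in> I" "l n i \<noteq> 0" by blast
    define J where "J = I - {i}"
    have J: "finite J" "i \<notin> J" "I = insert i J" using Suc.prems i by (auto simp: J_def)
    define l' where "l' j k = l j k - l n k / l n i * l j i" for j k
    have "n < card J" using Suc.prems(2) J by simp
    then obtain x where x: "\<exists>k\<in>J. x k \<noteq> 0" "\<forall>j<n. (\<Sum>k\<in>J. x k * l' j k) = 0"
      using Suc.IH[of J l', OF J(1)] by blast
    define y where "y = x(i := - (\<Sum>k\<in>J. x k * l n k) / l n i)"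
    have reduce: "(\<Sum>k\<in>I. y k * l j k) = (\<Sum>k\<in>J. x k * l' j k)" for j
    proof -
      have "(\<Sum>k\<in>J. y k * l j k) = (\<Sum>k\<in>J. x k * l j k)"
        by (rule sum.cong) (use J in \<open>auto simp: y_def\<close>)
      then have "(\<Sum>k\<in>I. y k * l j k) = (\<Sum>k\<in>J. x k * l j k) - (\<Sum>k\<in>J. x k * l n k) * (l j i / l n i)"
        using J by (simp add: y_def)
      also have "\<dots> = (\<Sum>k\<in>J. x k * l' j k)"
        unfolding sum_distrib_right sum_subtractf[symmetric]
        by (rule sum.cong) (simp_all add: l'_def algebra_simps)
      finally show ?thesis .
    qed
    have "(\<Sum>k\<in>J. x k * l' n k) = 0" using i by (simp add: l'_def)
    then have "\<forall>j<Suc n. (\<Sum>k\<in>I. y k * l j k) = 0" unfolding reduce using x(2) by (simp add: less_Suc_eq)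
    moreover have "\<exists>k\<in>I. y k \<noteq> 0"
    proof -
      obtain k where "k \<in> J" "x k \<noteq> 0" using x(1) by blast
      then show ?thesis using J by (intro bexI[of _ k]) (auto simp: y_def)
    qed
    ultimately show ?thesis by blast
  qed
qed

lemma info_coordinates:
  "info (\<lambda>ys f. inner (e (length ys)) f) f k = map (\<lambda>i. inner (e i) f) [0..<k]"
  by (induction k) auto

lemma length_info: "length (info L f k) = k"
  by (induction k) auto

context
  fixes S :: "'f::real_inner \<Rightarrow> 'g::real_inner" and e :: "nat \<Rightarrow> 'f"
  assumes S: "bounded_linear S" and e: "singular_system S e"
begin

lemma singular_truncation_info:
  "singular_truncation S e n f =
    (\<Sum>i<n. info (\<lambda>ys f. inner (e (length ys)) f) f n ! i *\<^sub>R S (e i))"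
  unfolding singular_truncation_def[OF bounded_linear.linear[OF S] e] info_coordinates by simp

lemma min_wor_error_le_singular: "min_wor_error continuous_functionals n S \<le> ennreal (norm (S (e n)))"
proof -
  have "det_algorithm continuous_functionals n (singular_truncation S e n)"
    unfolding det_algorithm_def
    by (rule exI[of _ "\<lambda>ys f. inner (e (length ys)) f"], rule exI[of _ "\<lambda>ys. \<Sum>i<n. ys ! i *\<^sub>R S (e i)"])
       (auto simp: continuous_functionals_def bounded_linear_inner_right singular_truncation_info)
  then have "min_wor_error continuous_functionals n S \<le> wor_error S (singular_truncation S e n)"
    unfolding min_wor_error_def by (intro INF_lower) simp
  also have "\<dots> \<le> ennreal (norm (S (e n)))"
    unfolding wor_error_def
  proof (intro SUP_least ennreal_leI)
    fix f :: 'f assume "f \<in> {f. norm f < 1}"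
    then have "norm (S (e n)) * norm f \<le> norm (S (e n)) * 1" by (intro mult_left_mono) auto
    then show "norm (S f - singular_truncation S e n f) \<le> norm (S (e n))"
      using singular_truncation_error[OF bounded_linear.linear[OF S] e, of f n] by linarith
  qed
  finally show ?thesis .
qed

text \<open>A vector and its negative that both produce only zeros receive the same output, so one
  of the two errors is at least the norm of the image.\<close>

lemma min_wor_error_ge_singular: "ennreal (norm (S (e n))) \<le> min_wor_error continuous_functionals n S"
  unfolding min_wor_error_def
proof (rule INF_greatest)
  fix A :: "'f \<Rightarrow> 'g" assume "A \<in> {A. det_algorithm continuous_functionals n A}"
  then obtain L \<phi> where L: "\<And>ys. length ys < n \<Longrightarrow> bounded_linear (L ys)" and A: "A = (\<lambda>f. \<phi> (info L f n))"
    by (auto simp: det_algorithm_def continuous_functionals_def)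
  note lin = bounded_linear.linear[OF S]
  show "ennreal (norm (S (e n))) \<le> wor_error S A"
  proof (cases "wor_error S A = \<top> \<or> S (e n) = 0")
    case True
    then show ?thesis by auto
  next
    case False
    then obtain W where W: "wor_error S A = ennreal W" "0 \<le> W" by (cases "wor_error S A") auto
    define s where "s = norm (S (e n))"
    have s: "0 < s" using False by (simp add: s_def)
    define I where "I = {..n}"
    have I: "finite I" "orthonormal_family e I"
      using singular_orthonormal[OF lin e, of n] s by (auto simp: I_def s_def)
    \<comment> \<open>Only the functionals chosen after a history of zeros matter: \<open>n\<close>
      equations for the \<open>n + 1\<close> coefficients indexed by \<open>{..n}\<close>.\<close>
    obtain x where x: "\<exists>i\<in>I. x i \<noteq> 0" "\<forall>j<n. (\<Sum>i\<in>I. x i * L (replicate j 0) (e i)) = 0"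
      using common_kernel[OF I(1), of n "\<lambda>j i. L (replicate j 0) (e i)"] by (auto simp: I_def)
    define f where "f = affine_param 0 e I x"
    have "f \<noteq> 0"
      using x(1) inner_affine_param_orthonormal[OF I, of _ x] by (auto simp: f_def)
    have Lf: "L (replicate j 0) (r *\<^sub>R f) = 0" if "j < n" for j r
    proof -
      have l: "linear (L (replicate j 0))" using L that by (simp add: bounded_linear.linear)
      show ?thesis
        using x(2) that unfolding f_def linear_cmul[OF l] linear_affine_param[OF l]
        by (simp add: linear_0[OF l])
    qed
    have hist: "info L (r *\<^sub>R f) k = replicate k 0" if "k \<le> n" for k r
      using that by (induction k) (simp_all add: Lf replicate_append_same)
    have Sf: "s * norm f \<le> norm (S f)"
    proof -
      \<comment> \<open>Taking 0 as the output turns the pull-back estimate into a lower bound for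
        \<open>S\<close> on the span.\<close>
      have "pseudo_inverse S e I 0 = 0" by (simp add: pseudo_inverse_def affine_param_def)
      moreover have "s\<^sup>2 * (norm (f - pseudo_inverse S e I 0))\<^sup>2 \<le> (norm (S f - 0))\<^sup>2"
        unfolding f_def
      proof (rule pseudo_inverse_error[OF lin I _ s])
        show "inner (S (e i)) (S (e j)) = 0" if "i \<noteq> j" for i j
          using that by (rule singular_image_orthogonal[OF lin e])
        show "s \<le> norm (S (e i))" if "i \<in> I" for i
          unfolding s_def by (rule singular_antimono[OF lin e]) (use that in \<open>simp add: I_def\<close>)
      qed
      ultimately have "(s * norm f)\<^sup>2 \<le> (norm (S f))\<^sup>2" by (simp add: power_mult_distrib)
      then show ?thesis by (rule power2_le_imp_le) simp
    qed
    \<comment> \<open>The ball is open, so the vector is scaled to norm \<open>\<theta> < 1\<close>,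
      and \<open>\<theta>\<close> then tends to 1.\<close>
    have "s * \<theta> \<le> W" if \<theta>: "0 < \<theta>" "\<theta> < 1" for \<theta>
    proof -
      define r where "r = \<theta> / norm f"
      define g where "g = \<phi> (replicate n 0)"
      have r: "0 < r" "r * norm f = \<theta>" using \<theta> \<open>f \<noteq> 0\<close> by (auto simp: r_def)
      have le: "norm (S (t *\<^sub>R f) - g) \<le> W" if "\<bar>t\<bar> = r" for t
      proof -
        have "norm (t *\<^sub>R f) < 1" using that r \<theta> by simp
        then have "ennreal (norm (S (t *\<^sub>R f) - A (t *\<^sub>R f))) \<le> wor_error S A"
          unfolding wor_error_def by (intro SUP_upper) simp
        then show ?thesis using W by (simp add: A hist g_def)
      qed
      have "2 * norm (S (r *\<^sub>R f)) = norm ((S (r *\<^sub>R f) - g) - (S ((- r) *\<^sub>R f) - g))"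
      proof -
        have "(S (r *\<^sub>R f) - g) - (S ((- r) *\<^sub>R f) - g) = 2 *\<^sub>R S (r *\<^sub>R f)"
          using linear_cmul[OF lin, of r f] linear_cmul[OF lin, of "- r" f] by (simp flip: scaleR_add_left)
        then show ?thesis by simp
      qed
      also have "\<dots> \<le> norm (S (r *\<^sub>R f) - g) + norm (S ((- r) *\<^sub>R f) - g)"
        by (rule norm_triangle_ineq4)
      also have "\<dots> \<le> W + W" by (intro add_mono le) (use r in auto)
      finally have "norm (S (r *\<^sub>R f)) \<le> W" by simp
      moreover have "norm (S (r *\<^sub>R f)) = r * norm (S f)" using r by (simp add: linear_cmul[OF lin])
      moreover have "r * (s * norm f) \<le> r * norm (S f)" using Sf r by (intro mult_left_mono) auto
      moreover have "r * (s * norm f) = s * \<theta>" unfolding r(2)[symmetric] by simp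
      ultimately show ?thesis by linarith
    qed
    then have "\<theta> * s \<le> W" if "0 < \<theta>" "\<theta> < 1" for \<theta> using that by (simp add: mult.commute)
    then have "s \<le> W" by (rule field_le_mult_one_interval)
    then show ?thesis unfolding W s_def by (rule ennreal_leI)
  qed
qed

text \<open>The truncation is continuous and therefore yields a measurable randomized algorithm. An
  arbitrary deterministic algorithm need not be measurable, so the comparison with the worst case
  passes through the singular values.\<close>

lemma min_ran_error_le_singular:
  "min_ran_error TYPE('w) linear_functionals n S \<le> ennreal (norm (S (e n)))"
proof -
  note lin = bounded_linear.linear[OF S]
  define A :: "('w, 'f, 'g) randomized_algorithm" where
    \<comment> \<open>A point mass exists on every type of elementary events; which point carries it
      is irrelevant.\<close>
    "A = \<lparr>space_of = return (count_space UNIV) undefined,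
      choose_functional = (\<lambda>_ ys f. inner (e (length ys)) f),
      stop_rule = (\<lambda>_ ys. n \<le> length ys),
      output_map = (\<lambda>_ ys. \<Sum>i<n. ys ! i *\<^sub>R S (e i))\<rparr>"
  have num: "num_used A f \<omega> = n" for f \<omega>
    unfolding num_used_def A_def by (simp add: length_info) (rule Least_equality, auto)
  have run: "run A f \<omega> = singular_truncation S e n f" for f \<omega>
    unfolding run_def num by (simp add: A_def singular_truncation_info)
  have prob: "prob_space (space_of A)"
    by (simp add: A_def prob_space_return)
  have "continuous_on UNIV (singular_truncation S e n)"
    unfolding singular_truncation_def[OF lin e] by (intro continuous_intros)
  then have "(\<lambda>(f, \<omega>). run A f \<omega>) \<in> borel \<Otimes>\<^sub>M space_of A \<rightarrow>\<^sub>M borel"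
    unfolding run case_prod_beta'
    by (rule measurable_compose[OF measurable_fst borel_measurable_continuous_onI])
  moreover have num_const: "(\<lambda>(f, \<omega>). num_used A f \<omega>) = (\<lambda>_. n)"
    by (auto simp: num)
  moreover have "linear (choose_functional A \<omega> ys)" for \<omega> ys
    by (simp add: A_def bounded_linear.linear[OF bounded_linear_inner_right])
  moreover have "\<exists>k. stop_rule A \<omega> (info (choose_functional A \<omega>) f k)" for \<omega> f
    by (rule exI[of _ n]) (simp add: A_def length_info)
  ultimately have valid: "valid_randomized linear_functionals A"
    unfolding valid_randomized_def using prob num_const by (simp add: linear_functionals_def)
  have "ran_cardinality A \<le> of_nat n"
    unfolding ran_cardinality_def num
    by (intro SUP_least) (simp add: prob_space.emeasure_space_1[OF prob])
  with valid have "min_ran_error TYPE('w) linear_functionals n S \<le> ran_error S A"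
    unfolding min_ran_error_def by (intro INF_lower) simp
  also have "\<dots> \<le> ennreal (norm (S (e n)))"
    unfolding ran_error_def
  proof (rule SUP_least)
    fix f :: 'f assume "f \<in> {f. norm f < 1}"
    then have "norm (S (e n)) * norm f \<le> norm (S (e n)) * 1" by (intro mult_left_mono) auto
    then have "norm (S f - singular_truncation S e n f) \<le> norm (S (e n))"
      using singular_truncation_error[OF lin e, of f n] by linarith
    then show "ennreal_sqrt (\<integral>\<^sup>+\<omega>. ennreal ((norm (S f - run A f \<omega>))\<^sup>2) \<partial>space_of A) \<le> ennreal (norm (S (e n)))"
      by (simp add: run prob_space.emeasure_space_1[OF prob] ennreal_sqrt_def ennreal_leI)
  qed
  finally show ?thesis .
qed

end

theorem theorem2:
  fixes S :: "'f::{real_inner, banach} \<Rightarrow> 'g::{real_inner, banach}"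
    and n :: nat
  assumes "compact_linear_operator S"
    and "n \<ge> 1"
  shows "(1 / 2) * min_wor_error continuous_functionals (4 * n - 1) S
           \<le> min_ran_error TYPE('w) linear_functionals n S
       \<and> min_ran_error TYPE('w) linear_functionals n S
           \<le> min_wor_error continuous_functionals n S"
proof
  have S: "bounded_linear S" by (rule compact_linear_operator_bounded_linear[OF assms(1)])
  note lin = bounded_linear.linear[OF S]
  obtain e where e: "singular_system S e" using singular_system_exists[OF assms(1)] by blast
  show "min_ran_error TYPE('w) linear_functionals n S \<le> min_wor_error continuous_functionals n S"
    using min_ran_error_le_singular[OF S e] min_wor_error_ge_singular[OF S e] by (rule order_trans)
  \<comment> \<open>Indexing starts at 0, so the \<open>4 * n\<close> vectors used by the averaging
    argument end at index \<open>4 * n - 1\<close>, and the last of them has the smallest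
    image.\<close>
  define N where "N = 4 * n - 1"
  define s where "s = norm (S (e N))"
  have half: "(1 / 2 :: ennreal) = ennreal (1 / 2)"
    using divide_ennreal[of 1 2] by simp
  have "(1 / 2) * min_wor_error continuous_functionals N S \<le> (1 / 2) * ennreal s"
    unfolding s_def by (rule mult_left_mono[OF min_wor_error_le_singular[OF S e]]) simp
  also have "\<dots> = ennreal (s / 2)"
    unfolding half by (subst ennreal_mult[symmetric]) (simp_all add: s_def)
  also have "\<dots> \<le> min_ran_error TYPE('w) linear_functionals n S"
    unfolding min_ran_error_def
  proof (rule INF_greatest)
    fix A :: "('w, 'f, 'g) randomized_algorithm"
    assume A: "A \<in> {A. valid_randomized linear_functionals A \<and> ran_cardinality A \<le> of_nat n}"
    show "ennreal (s / 2) \<le> ran_error S A"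
    proof (cases "s = 0")
      case True
      then show ?thesis by simp
    next
      case False
      then have s: "0 < s" by (simp add: s_def)
      have idx: "{..<4 * n} = {..N}" using assms(2) by (auto simp: N_def)
      show ?thesis
      proof (rule randomized_lower_bound[OF lin assms(2)])
        show "orthonormal_family e {..<4 * n}"
          unfolding idx by (rule singular_orthonormal[OF lin e]) (use s in \<open>simp add: s_def\<close>)
        show "inner (S (e i)) (S (e j)) = 0" if "i \<noteq> j" for i j
          using that by (rule singular_image_orthogonal[OF lin e])
        show "s \<le> norm (S (e i))" if "i < 4 * n" for i
          unfolding s_def by (rule singular_antimono[OF lin e]) (use that in \<open>simp add: N_def\<close>)
      qed (use s A in auto)
    qed
  qed
  finally show "(1 / 2) * min_wor_error continuous_functionals (4 * n - 1) S
      \<le> min_ran_error TYPE('w) linear_functionals n S"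
    unfolding N_def .
qed

end
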